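(* Let $n\ge 1$ and let $X$ be a locally $n$-connected topological space. Then for each $x\in X$, $\pi_n^{top}(X,x)$ is a discrete topological group.
   Context: For a pointed space $(X,x)$, $\Omega^n(X,x)$ is the space of $n$-loops (continuous maps $(I^n,\partial I^n)\to(X,x)$) with the compact-open topology, and $\pi_n^{top}(X,x)$ is the $n$-th homotopy group $\pi_n(X,x)$ with the quotient topology from the surjection $\Omega^n(X,x)\to\pi_n(X,x)$, $\alpha\mapsto[\alpha]$. A space $X$ is locally $n$-connected if for every $x\in X$ and every neighborhood $U$ of $x$ there is a neighborhood $V\subseteq U$ of $x$ such that every continuous map $S^k\to V$, $0\le k\le n$, is nullhomotopic in $U$. *)

theory Defs
  imports "HOL-Analysis.Analysis" "HOL-Algebra.Group"
begin

section \<open>Topological preliminaries\<close>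

text \<open>Continuous maps are represented by functions that are extensional on the
  space they are defined on, so that equality of functions is equality of maps.\<close>

definition compact_open_topology :: "'a topology \<Rightarrow> 'b topology \<Rightarrow> ('a \<Rightarrow> 'b) topology"
  where "compact_open_topology X Y =
    topology_generated_by
      {{f \<in> extensional (topspace X). continuous_map X Y f \<and> f ` K \<subseteq> U} | K U.
         compactin X K \<and> openin Y U}"

lemma topspace_compact_open_topology:
  "topspace (compact_open_topology X Y) =
     {f \<in> extensional (topspace X). continuous_map X Y f}"
proof -
  have "{f \<in> extensional (topspace X). continuous_map X Y f} \<in>
      {{f \<in> extensional (topspace X). continuous_map X Y f \<and> f ` K \<subseteq> U} | K U.
         compactin X K \<and> openin Y U}"
    by (rule CollectI, rule exI[of _ "{}"], rule exI[of _ "{}"]) auto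
  then show ?thesis
    unfolding compact_open_topology_def topology_generated_by_topspace by blast
qed

definition quotient_topology :: "'a topology \<Rightarrow> ('a \<Rightarrow> 'b) \<Rightarrow> 'b topology"
  where "quotient_topology X q =
    topology (\<lambda>U. U \<subseteq> q ` topspace X \<and> openin X {x \<in> topspace X. q x \<in> U})"

lemma openin_quotient_topology:
  "openin (quotient_topology X q) U \<longleftrightarrow>
     U \<subseteq> q ` topspace X \<and> openin X {x \<in> topspace X. q x \<in> U}"
proof -
  have "istopology (\<lambda>U. U \<subseteq> q ` topspace X \<and> openin X {x \<in> topspace X. q x \<in> U})"
    unfolding istopology_def
  proof (intro conjI allI impI)
    fix S T
    assume S: "S \<subseteq> q ` topspace X \<and> openin X {x \<in> topspace X. q x \<in> S}"
      and T: "T \<subseteq> q ` topspace X \<and> openin X {x \<in> topspace X. q x \<in> T}"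
    have "{x \<in> topspace X. q x \<in> S \<inter> T} =
        {x \<in> topspace X. q x \<in> S} \<inter> {x \<in> topspace X. q x \<in> T}" by blast
    then show "openin X {x \<in> topspace X. q x \<in> S \<inter> T}"
      using S T by (simp add: openin_Int)
    show "S \<inter> T \<subseteq> q ` topspace X" using S by blast
  next
    fix \<K>
    assume K: "\<forall>K\<in>\<K>. K \<subseteq> q ` topspace X \<and> openin X {x \<in> topspace X. q x \<in> K}"
    have "{x \<in> topspace X. q x \<in> \<Union> \<K>} = (\<Union>K\<in>\<K>. {x \<in> topspace X. q x \<in> K})" by blast
    then show "openin X {x \<in> topspace X. q x \<in> \<Union> \<K>}"
      using K by (simp add: openin_clauses)
    show "\<Union> \<K> \<subseteq> q ` topspace X" using K by blast
  qed
  then show ?thesis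
    by (simp add: quotient_topology_def topology_inverse')
qed

lemma quotient_map_quotient_topology: "quotient_map X (quotient_topology X q) q"
proof -
  have "topspace (quotient_topology X q) = q ` topspace X"
  proof (rule subset_antisym)
    show "topspace (quotient_topology X q) \<subseteq> q ` topspace X"
      by (meson openin_quotient_topology openin_topspace)
    have "{a \<in> topspace X. q a \<in> q ` topspace X} = topspace X" by blast
    then have "openin (quotient_topology X q) (q ` topspace X)"
      by (simp add: openin_quotient_topology)
    then show "q ` topspace X \<subseteq> topspace (quotient_topology X q)"
      by (rule openin_subset)
  qed
  then show ?thesis
    by (simp add: quotient_map_def openin_quotient_topology)
qed

text \<open>Neighbourhoods are not required to be open, and null homotopies are free
  (the sphere carries no base point).\<close>

definition nbhd_of :: "'a topology \<Rightarrow> 'a \<Rightarrow> 'a set \<Rightarrow> bool"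
  where "nbhd_of X x U \<longleftrightarrow> U \<subseteq> topspace X \<and> x \<in> X interior_of U"

definition nullhomotopic_map :: "'a topology \<Rightarrow> 'b topology \<Rightarrow> ('a \<Rightarrow> 'b) \<Rightarrow> bool"
  where "nullhomotopic_map X Y f \<longleftrightarrow>
    (\<exists>c \<in> topspace Y. homotopic_with (\<lambda>_. True) X Y f (\<lambda>_. c))"

definition locally_n_connected :: "nat \<Rightarrow> 'a topology \<Rightarrow> bool"
  where "locally_n_connected n X \<longleftrightarrow>
    (\<forall>x \<in> topspace X. \<forall>U. nbhd_of X x U \<longrightarrow>
       (\<exists>V. nbhd_of X x V \<and> V \<subseteq> U \<and>
          (\<forall>k\<le>n. \<forall>f. continuous_map (nsphere k) (subtopology X V) f \<longrightarrow>
             nullhomotopic_map (nsphere k) (subtopology X U) f)))"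

locale topological_group = group G for G (structure) +
  fixes T :: "'a topology"
  assumes topspace_eq_carrier: "topspace T = carrier G"
    and continuous_mult: "continuous_map (prod_topology T T) T (\<lambda>(a, b). a \<otimes> b)"
    and continuous_inv: "continuous_map T T (\<lambda>a. inv a)"


section \<open>Homotopy groups\<close>

definition cube :: "nat \<Rightarrow> (nat \<Rightarrow> real) topology"
  where "cube n = subtopology (Euclidean_space n) {t. \<forall>i<n. t i \<in> {0..1}}"

definition cube_boundary :: "nat \<Rightarrow> (nat \<Rightarrow> real) set"
  where "cube_boundary n = {t \<in> topspace (cube n). \<exists>i<n. t i = 0 \<or> t i = 1}"

definition nloops :: "nat \<Rightarrow> 'a topology \<Rightarrow> 'a \<Rightarrow> ((nat \<Rightarrow> real) \<Rightarrow> 'a) set"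
  where "nloops n X x =
    {f \<in> extensional (topspace (cube n)).
       continuous_map (cube n) X f \<and> (\<forall>t \<in> cube_boundary n. f t = x)}"

definition nloop_space :: "nat \<Rightarrow> 'a topology \<Rightarrow> 'a \<Rightarrow> ((nat \<Rightarrow> real) \<Rightarrow> 'a) topology"
  where "nloop_space n X x = subtopology (compact_open_topology (cube n) X) (nloops n X x)"

lemma topspace_nloop_space: "topspace (nloop_space n X x) = nloops n X x"
  by (auto simp: nloop_space_def topspace_compact_open_topology nloops_def)

definition nloop_homotopy ::
    "nat \<Rightarrow> 'a topology \<Rightarrow> 'a \<Rightarrow> (((nat \<Rightarrow> real) \<Rightarrow> 'a) \<times> ((nat \<Rightarrow> real) \<Rightarrow> 'a)) set"
  where "nloop_homotopy n X x =
    {(f, g). f \<in> nloops n X x \<and> g \<in> nloops n X x \<and>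
       homotopic_with (\<lambda>h. \<forall>t \<in> cube_boundary n. h t = x) (cube n) X f g}"

definition nloop_class ::
    "nat \<Rightarrow> 'a topology \<Rightarrow> 'a \<Rightarrow> ((nat \<Rightarrow> real) \<Rightarrow> 'a) \<Rightarrow> ((nat \<Rightarrow> real) \<Rightarrow> 'a) set"
  where "nloop_class n X x f = nloop_homotopy n X x `` {f}"

definition nloop_concat ::
    "nat \<Rightarrow> ((nat \<Rightarrow> real) \<Rightarrow> 'a) \<Rightarrow> ((nat \<Rightarrow> real) \<Rightarrow> 'a) \<Rightarrow> (nat \<Rightarrow> real) \<Rightarrow> 'a"
  where "nloop_concat n f g =
    (\<lambda>t \<in> topspace (cube n).
       if t 0 \<le> 1/2 then f (t(0 := 2 * t 0)) else g (t(0 := 2 * t 0 - 1)))"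

text \<open>Concatenation uses the coordinate with index 0, so this is the homotopy
  group only for \<open>n \<ge> 1\<close>.\<close>

definition homotopy_group ::
    "nat \<Rightarrow> 'a topology \<Rightarrow> 'a \<Rightarrow> ((nat \<Rightarrow> real) \<Rightarrow> 'a) set monoid"
  where "homotopy_group n X x =
    \<lparr>carrier = nloops n X x // nloop_homotopy n X x,
     monoid.mult = (\<lambda>A B. \<Union>f\<in>A. \<Union>g\<in>B. nloop_class n X x (nloop_concat n f g)),
     one = nloop_class n X x (\<lambda>t \<in> topspace (cube n). x)\<rparr>"

definition homotopy_group_topology ::
    "nat \<Rightarrow> 'a topology \<Rightarrow> 'a \<Rightarrow> ((nat \<Rightarrow> real) \<Rightarrow> 'a) set topology"
  where "homotopy_group_topology n X x =
    quotient_topology (nloop_space n X x) (nloop_class n X x)"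

end

theory Submission
  imports Defs
begin

text \<open>Call a space \<open>Y\<close> \<open>k\<close>-fillable if every point has arbitrarily small neighbourhoods in which maps
  from the boundary of the \<open>(k + 1)\<close>-cube extend to the cube. A locally \<open>n\<close>-connected space is
  \<open>k\<close>-fillable for all \<open>k \<le> n\<close>, since the cube is a quotient of the cylinder over the sphere. If \<open>Y\<close> is \<open>k\<close>-
  and \<open>(k + 1)\<close>-fillable, then its loop space is \<open>k\<close>-fillable: cut the unit interval into small pieces,
  fill in dimension \<open>k\<close> over the cut points and then in dimension \<open>k + 1\<close> over each piece. As the
  \<open>(j + 1)\<close>-fold loop space is the loop space of the \<open>j\<close>-fold one, the \<open>n\<close>-fold loop space of \<open>X\<close> is
  \<open>0\<close>-fillable, i.e. locally path-connected. Paths of \<open>n\<close>-loops are homotopies, so homotopy classes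
  are open.\<close>

section \<open>Cubes\<close>

text \<open>A short slab has its whole boundary prescribed only once its two end faces are filled.
  The end faces cost dimension \<open>k\<close>, the slab itself \<open>k + 1\<close>; so every loop
  coordinate uses up one degree of connectivity, and \<open>n\<close> of them leave dimension 0. The
  obstacle is the order of choices. The filling over a cut point must suit both adjacent slabs,
  while the neighbourhood that confines the boundary loops has to be fixed before these loops are
  known. Slab fillability therefore chooses its neighbourhoods before the data, and gluing two slabs
  fixes the sets for the common face from those of both sides. In this form the property is additive
  over adjacent intervals and true on short ones, so \<open>Bolzano\<close> yields it on
  \<open>{0..1}\<close> without an explicit subdivision. For a general \<open>X\<close>,
  multiplication on the quotient need not be jointly continuous, since a product of two quotient
  maps need not be a quotient map. Here discreteness settles continuity, and only the group axioms
  remain to be checked.\<close>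

lemma cube_eq: "cube n = top_of_set {t. (\<forall>i<n. t i \<in> {0..1}) \<and> (\<forall>i\<ge>n. t i = 0)}"
  unfolding cube_def Euclidean_space_def subtopology_subtopology euclidean_product_topology
  by (rule arg_cong[where f = "top_of_set"]) auto

lemma topspace_cube: "topspace (cube n) = {t. (\<forall>i<n. t i \<in> {0..1}) \<and> (\<forall>i\<ge>n. t i = 0)}"
  by (simp add: cube_eq)

lemma continuous_map_into_cube:
  "continuous_map Z (cube n) f \<longleftrightarrow>
    (\<forall>i<n. continuous_map Z euclideanreal (\<lambda>z. f z i)) \<and> f \<in> topspace Z \<rightarrow> topspace (cube n)"
proof -
  have "continuous_map Z (powertop_real UNIV) f \<longleftrightarrow> (\<forall>i<n. continuous_map Z euclideanreal (\<lambda>z. f z i))"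
    if f: "f \<in> topspace Z \<rightarrow> topspace (cube n)"
  proof -
    have "continuous_map Z euclideanreal (\<lambda>z. f z i)" if "i \<ge> n" for i
      by (rule continuous_map_eq[of _ _ "\<lambda>_. 0"]) (use f that in \<open>auto simp: topspace_cube Pi_iff\<close>)
    then show ?thesis
      unfolding continuous_map_componentwise_UNIV by (meson not_le)
  qed
  then show ?thesis
    unfolding cube_def Euclidean_space_def subtopology_subtopology continuous_map_in_subtopology
    by (auto simp: topspace_Euclidean_space)
qed

lemma continuous_map_cube_coord:
  assumes "continuous_map Z (cube n) f"
  shows "continuous_map Z euclideanreal (\<lambda>z. f z i)"
proof (cases "i < n")
  case True
  then show ?thesis using assms by (simp add: continuous_map_into_cube)
next
  case False
  show ?thesis
    by (rule continuous_map_eq[of _ _ "\<lambda>_. 0"])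
       (use False assms in \<open>auto simp: continuous_map_into_cube topspace_cube Pi_iff\<close>)
qed

lemma compact_space_cube: "compact_space (cube n)"
proof -
  have "{t :: nat \<Rightarrow> real. (\<forall>i<n. t i \<in> {0..1}) \<and> (\<forall>i\<ge>n. t i = 0)} =
      Pi\<^sub>E UNIV (\<lambda>i. if i < n then {0..1} else {0})"
    by (auto simp: PiE_iff split: if_splits)
  moreover have "compactin (powertop_real UNIV) (Pi\<^sub>E UNIV (\<lambda>i. if i < n then {0..1} else {0}))"
    by (auto simp: compactin_PiE)
  ultimately show ?thesis
    by (simp add: cube_eq euclidean_product_topology compact_space_subtopology)
qed

lemma Hausdorff_space_cube: "Hausdorff_space (cube n)"
  by (simp add: cube_eq Hausdorff_space_subtopology)

lemma cube_upd:
  assumes "t \<in> topspace (cube n)" "i < n" "s \<in> {0..1}"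
  shows "t(i := s) \<in> topspace (cube n)"
  using assms by (auto simp: topspace_cube)

lemma cube_upd_boundary:
  assumes "t \<in> topspace (cube n)" "i < n" "s = 0 \<or> s = 1"
  shows "t(i := s) \<in> cube_boundary n"
  using assms by (auto simp: topspace_cube cube_boundary_def)

lemma cube_boundary_subset: "cube_boundary n \<subseteq> topspace (cube n)"
  by (auto simp: cube_boundary_def)

lemma continuous_map_cube_upd:
  assumes "continuous_map Z (cube n) f" "continuous_map Z (top_of_set {0..1}) u" "i < n"
  shows "continuous_map Z (cube n) (\<lambda>z. (f z)(i := u z))"
  unfolding continuous_map_into_cube
proof (intro conjI allI impI)
  have u: "continuous_map Z euclideanreal u"
    using assms(2) by (simp add: continuous_map_in_subtopology)
  \<comment> \<open>This moves the case split outside the abstraction, so that each coordinate is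
    one of two whole functions already known to be continuous.\<close>
  have eq: "(\<lambda>z. ((f z)(i := u z)) j) = (if j = i then u else (\<lambda>z. f z j))" for j
    by auto
  show "continuous_map Z euclideanreal (\<lambda>z. ((f z)(i := u z)) j)" if "j < n" for j
    unfolding eq by (simp only: u continuous_map_cube_coord[OF assms(1)] simp_thms split: if_split)
  show "(\<lambda>z. (f z)(i := u z)) \<in> topspace Z \<rightarrow> topspace (cube n)"
    using continuous_map_funspace[OF assms(1)] continuous_map_funspace[OF assms(2)] assms(3) cube_upd
    by (simp add: Pi_iff)
qed

section \<open>The cube as a product with the interval\<close>

text \<open>Points of \<open>cube n\<close> are 0 at index \<open>n\<close>. Overwriting that entry
  therefore realises the product of \<open>cube n\<close> with the interval as
  \<open>cube (Suc n)\<close>, and resetting it to 0 is the projection.\<close>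

lemma cube_SucI:
  assumes "t \<in> topspace (cube n)" "s \<in> {0..1}"
  shows "t(n := s) \<in> topspace (cube (Suc n))"
  using assms by (auto simp: topspace_cube less_Suc_eq)

lemma cube_SucD:
  assumes "t \<in> topspace (cube (Suc n))"
  shows "t(n := 0) \<in> topspace (cube n)" "t n \<in> {0..1}"
  using assms by (auto simp: topspace_cube)

lemma cube_restore [simp]: "t \<in> topspace (cube n) \<Longrightarrow> t(n := 0) = t"
  by (auto simp: topspace_cube fun_eq_iff)

text \<open>The boundary of a product with an interval is the side wall together with two lids. This
  description is used both for loops of loops and for the boundary of a slab.\<close>

lemma cube_boundary_Suc:
  assumes "t \<in> topspace (cube (Suc n))"
  shows "t \<in> cube_boundary (Suc n) \<longleftrightarrow> t(n := 0) \<in> cube_boundary n \<or> t n = 0 \<or> t n = 1"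
proof -
  have "(\<exists>i<n. (t(n := 0)) i = 0 \<or> (t(n := 0)) i = 1) \<longleftrightarrow> (\<exists>i<n. t i = 0 \<or> t i = 1)"
    by auto
  then show ?thesis
    using assms cube_SucD(1)[OF assms] unfolding cube_boundary_def Ex_less_Suc by blast
qed

lemma continuous_map_cube_join:
  assumes "continuous_map Z (cube n) f" "continuous_map Z (top_of_set {0..1}) u"
  shows "continuous_map Z (cube (Suc n)) (\<lambda>z. (f z)(n := u z))"
  unfolding continuous_map_into_cube
proof (intro conjI allI impI)
  have u: "continuous_map Z euclideanreal u"
    using assms(2) by (simp add: continuous_map_in_subtopology)
  have eq: "(\<lambda>z. ((f z)(n := u z)) j) = (if j = n then u else (\<lambda>z. f z j))" for j
    by auto
  show "continuous_map Z euclideanreal (\<lambda>z. ((f z)(n := u z)) j)" for j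
    unfolding eq by (simp only: u continuous_map_cube_coord[OF assms(1)] simp_thms split: if_split)
  show "(\<lambda>z. (f z)(n := u z)) \<in> topspace Z \<rightarrow> topspace (cube (Suc n))"
    using continuous_map_funspace[OF assms(1)] continuous_map_funspace[OF assms(2)] cube_SucI
    by (simp add: Pi_iff)
qed

lemma continuous_map_cube_init:
  assumes "continuous_map Z (cube (Suc n)) f"
  shows "continuous_map Z (cube n) (\<lambda>z. (f z)(n := 0))"
  unfolding continuous_map_into_cube
proof (intro conjI allI impI)
  have eq: "(\<lambda>z. ((f z)(n := 0)) j) = (if j = n then (\<lambda>_. 0) else (\<lambda>z. f z j))" for j
    by auto
  show "continuous_map Z euclideanreal (\<lambda>z. ((f z)(n := 0)) j)" for j
    unfolding eq by (simp only: continuous_map_const continuous_map_cube_coord[OF assms(1)] topspace_euclidean UNIV_I simp_thms split: if_split)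
  show "(\<lambda>z. (f z)(n := 0)) \<in> topspace Z \<rightarrow> topspace (cube n)"
    using continuous_map_funspace[OF assms(1)] cube_SucD(1) by (simp add: Pi_iff)
qed

lemma continuous_map_cube_coord01:
  assumes "continuous_map Z (cube n) f" "i < n"
  shows "continuous_map Z (top_of_set {0..1}) (\<lambda>z. f z i)"
  using continuous_map_funspace[OF assms(1)] assms(2) continuous_map_cube_coord[OF assms(1), of i]
  by (auto simp: continuous_map_in_subtopology topspace_cube Pi_iff)

lemma continuous_map_fst_comp:
  "continuous_map Z (prod_topology X Y) f \<Longrightarrow> continuous_map Z X (\<lambda>z. fst (f z))"
  using continuous_map_fst_of[unfolded o_def] .

lemma continuous_map_snd_comp:
  "continuous_map Z (prod_topology X Y) f \<Longrightarrow> continuous_map Z Y (\<lambda>z. snd (f z))"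
  using continuous_map_snd_of[unfolded o_def] .

section \<open>The compact-open topology\<close>

lemma openin_compact_open_subbase:
  assumes "compactin B K" "openin X U"
  shows "openin (compact_open_topology B X)
    {f \<in> extensional (topspace B). continuous_map B X f \<and> f ` K \<subseteq> U}"
  unfolding compact_open_topology_def by (rule topology_generated_by_Basis) (use assms in blast)

text \<open>Currying. If \<open>F a\<close> sends the compact set \<open>K\<close> into
  \<open>U\<close>, the tube lemma provides a neighbourhood of \<open>a\<close> whose members do the
  same on all of \<open>K\<close> at once.\<close>

lemma continuous_map_into_compact_open:
  assumes F: "continuous_map (prod_topology A B) X (\<lambda>(a, b). F a b)"
    and ext: "\<And>a. a \<in> topspace A \<Longrightarrow> F a \<in> extensional (topspace B)"
  shows "continuous_map A (compact_open_topology B X) F"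
proof -
  have cont: "continuous_map B X (F a)" if a: "a \<in> topspace A" for a
  proof -
    have "continuous_map B (prod_topology A B) (\<lambda>b. (a, b))"
      using a by (simp add: continuous_map_pairedI)
    from continuous_map_compose[OF this F] show ?thesis by (simp add: o_def)
  qed
  show ?thesis
    unfolding compact_open_topology_def
  proof (rule continuous_on_generated_topo, goal_cases)
    case (1 W)
    then obtain K U where K: "compactin B K" and U: "openin X U"
      and W: "W = {f \<in> extensional (topspace B). continuous_map B X f \<and> f ` K \<subseteq> U}"
      by blast
    have "F -` W \<inter> topspace A = {a \<in> topspace A. F a ` K \<subseteq> U}"
      using cont ext by (auto simp: W)
    moreover have "openin A {a \<in> topspace A. F a ` K \<subseteq> U}"
    proof (subst openin_subopen, safe)
      fix a assume a: "a \<in> topspace A" and aK: "F a ` K \<subseteq> U"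
      let ?P = "{p \<in> topspace (prod_topology A B). (\<lambda>(a, b). F a b) p \<in> U}"
      have P: "openin (prod_topology A B) ?P"
        by (rule openin_continuous_map_preimage[OF F U])
      have sub: "{a} \<times> K \<subseteq> ?P"
        using a aK compactin_subset_topspace[OF K] by auto
      obtain S V where SV: "openin A S" "a \<in> S" "K \<subseteq> V" "S \<times> V \<subseteq> ?P"
        using tube_lemma_right[OF P K a sub] by metis
      have "S \<subseteq> {a \<in> topspace A. F a ` K \<subseteq> U}"
      proof safe
        fix a' assume a': "a' \<in> S"
        show "a' \<in> topspace A" using a' openin_subset[OF SV(1)] by blast
        fix k assume "k \<in> K"
        then have "(a', k) \<in> ?P" using a' SV(3,4) by blast
        then show "F a' k \<in> U" by simp
      qed
      then show "\<exists>T. openin A T \<and> a \<in> T \<and> T \<subseteq> {a \<in> topspace A. F a ` K \<subseteq> U}"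
        using SV(1,2) by blast
    qed
    ultimately show ?case by simp
  next
    case 2
    show ?case
    proof (safe)
      fix a assume a: "a \<in> topspace A"
      have "F a \<in> topspace (compact_open_topology B X)"
        using a cont ext by (simp add: topspace_compact_open_topology)
      then show "F a \<in> \<Union> {{f \<in> extensional (topspace B). continuous_map B X f \<and> f ` K \<subseteq> U} | K U.
         compactin B K \<and> openin X U}"
        unfolding compact_open_topology_def topology_generated_by_topspace .
    qed
  qed
qed

text \<open>A compact Hausdorff space is locally compact, so \<open>b\<close> has a compact
  neighbourhood \<open>K\<close> that \<open>f\<close> still maps into \<open>U\<close>. Maps
  sending \<open>K\<close> into \<open>U\<close>, paired with points near \<open>b\<close>, form the
  required open set.\<close>

lemma continuous_map_eval:
  assumes "compact_space B" "Hausdorff_space B"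
  shows "continuous_map (prod_topology (compact_open_topology B X) B) X (\<lambda>(f, b). f b)"
proof -
  let ?C = "compact_open_topology B X"
  have nb: "neighbourhood_base_of (compactin B) B"
    using assms compact_imp_locally_compact_space locally_compact_space_neighbourhood_base by blast
  show ?thesis
    unfolding continuous_map_def
  proof (intro conjI allI impI)
    show "(\<lambda>(f, b). f b) \<in> topspace (prod_topology ?C B) \<rightarrow> topspace X"
      by (auto simp: topspace_compact_open_topology continuous_map_def)
    fix U assume U: "openin X U"
    show "openin (prod_topology ?C B) {p \<in> topspace (prod_topology ?C B). (\<lambda>(f, b). f b) p \<in> U}"
    proof (subst openin_subopen, safe)
      fix f b
      assume fb: "(f, b) \<in> topspace (prod_topology ?C B)" "f b \<in> U"
      then have f: "f \<in> extensional (topspace B)" "continuous_map B X f" and b: "b \<in> topspace B"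
        by (auto simp: topspace_compact_open_topology)
      have "openin B {b \<in> topspace B. f b \<in> U}"
        by (rule openin_continuous_map_preimage[OF f(2) U])
      then obtain V K where V: "openin B V" "compactin B K" "b \<in> V" "V \<subseteq> K" "K \<subseteq> {b \<in> topspace B. f b \<in> U}"
        using nb fb(2) b unfolding neighbourhood_base_of
        by (metis (mono_tags, lifting) mem_Collect_eq)
      let ?W = "{f \<in> extensional (topspace B). continuous_map B X f \<and> f ` K \<subseteq> U}"
      have "openin (prod_topology ?C B) (?W \<times> V)"
        using openin_compact_open_subbase[OF V(2) U] V(1) by (simp add: openin_prod_Times_iff)
      moreover have "(f, b) \<in> ?W \<times> V" using f V by auto
      moreover have "?W \<times> V \<subseteq> {p \<in> topspace (prod_topology ?C B). (\<lambda>(f, b). f b) p \<in> U}"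
        using V(4) openin_subset[OF V(1)] by (auto simp: topspace_compact_open_topology)
      ultimately show "\<exists>T. openin (prod_topology ?C B) T \<and> (f, b) \<in> T \<and>
          T \<subseteq> {p \<in> topspace (prod_topology ?C B). (\<lambda>(f, b). f b) p \<in> U}" by blast
    qed
  qed
qed

lemma continuous_map_eval_of:
  assumes "compact_space B" "Hausdorff_space B"
    and "continuous_map Z (compact_open_topology B X) f" "continuous_map Z B g"
  shows "continuous_map Z X (\<lambda>z. f z (g z))"
  using continuous_map_compose[OF continuous_map_pairedI[OF assms(3,4)] continuous_map_eval[OF assms(1,2)]]
  by (simp add: o_def)

section \<open>Loop spaces and the exponential law\<close>

text \<open>The parameter is a real number and not a point of \<open>cube 1\<close>, so that it can
  be cut at intermediate values and attached to a cube as a further coordinate.\<close>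

definition loop_space :: "'a topology \<Rightarrow> 'a \<Rightarrow> (real \<Rightarrow> 'a) topology"
  where "loop_space Y y =
    subtopology (compact_open_topology (top_of_set {0..1}) Y) {f. f 0 = y \<and> f 1 = y}"

lemma topspace_loop_space:
  "topspace (loop_space Y y) =
    {f \<in> extensional {0..1}. continuous_map (top_of_set {0..1}) Y f \<and> f 0 = y \<and> f 1 = y}"
  by (auto simp: loop_space_def topspace_compact_open_topology)

lemma compact_space_unit_interval: "compact_space (top_of_set {0..1::real})"
  by (simp add: compact_space_subtopology)

lemma Hausdorff_space_unit_interval: "Hausdorff_space (top_of_set {0..1::real})"
  by (simp add: Hausdorff_space_subtopology)

lemma continuous_map_loop_eval:
  assumes "continuous_map Z (loop_space Y y) f" "continuous_map Z (top_of_set {0..1}) g"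
  shows "continuous_map Z Y (\<lambda>z. f z (g z))"
  by (rule continuous_map_eval_of[OF compact_space_unit_interval Hausdorff_space_unit_interval _ assms(2)])
     (use assms(1) in \<open>simp add: loop_space_def continuous_map_in_subtopology\<close>)

lemma continuous_map_nloop_eval:
  assumes "continuous_map Z (nloop_space n X x) f" "continuous_map Z (cube n) g"
  shows "continuous_map Z X (\<lambda>z. f z (g z))"
  by (rule continuous_map_eval_of[OF compact_space_cube Hausdorff_space_cube _ assms(2)])
     (use assms(1) in \<open>simp add: nloop_space_def continuous_map_in_subtopology\<close>)

lemma continuous_map_into_loop_space:
  assumes "continuous_map (prod_topology A (top_of_set {0..1})) Y (\<lambda>(a, s). F a s)"
    and "\<And>a. a \<in> topspace A \<Longrightarrow> F a \<in> extensional {0..1} \<and> F a 0 = y \<and> F a 1 = y"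
  shows "continuous_map A (loop_space Y y) F"
  unfolding loop_space_def continuous_map_in_subtopology
  using continuous_map_into_compact_open[OF assms(1)] assms(2) by auto

lemma continuous_map_into_nloop_space:
  assumes "continuous_map (prod_topology A (cube n)) X (\<lambda>(a, t). F a t)"
    and "\<And>a. a \<in> topspace A \<Longrightarrow> F a \<in> extensional (topspace (cube n))"
    and "\<And>a t. a \<in> topspace A \<Longrightarrow> t \<in> cube_boundary n \<Longrightarrow> F a t = x"
  shows "continuous_map A (nloop_space n X x) F"
proof -
  have c: "continuous_map A (compact_open_topology (cube n) X) F"
    using continuous_map_into_compact_open[OF assms(1)] assms(2) by auto
  then have "F ` topspace A \<subseteq> topspace (compact_open_topology (cube n) X)"
    by (simp add: continuous_map_image_subset_topspace)
  then have "F ` topspace A \<subseteq> nloops n X x"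
    using assms(3) by (auto simp: nloops_def topspace_compact_open_topology)
  then show ?thesis
    using c unfolding nloop_space_def continuous_map_in_subtopology by blast
qed

text \<open>\<open>C\<close> reads the last coordinate as time and \<open>D\<close> puts it back;
  both are continuous by currying and evaluation, and the lids of the cube become the constant base
  loop. Concatenation works with coordinate 0 instead, but only the topology is transported along
  this map.\<close>

lemma nloop_space_Suc_homeomorphic:
  "nloop_space (Suc j) X x homeomorphic_space
     loop_space (nloop_space j X x) (\<lambda>t \<in> topspace (cube j). x)"
proof -
  let ?I = "top_of_set {0..1::real}"
  let ?N = "nloop_space (Suc j) X x" and ?c = "\<lambda>t \<in> topspace (cube j). x"
  let ?L = "loop_space (nloop_space j X x) ?c"
  define C where "C = (\<lambda>g. \<lambda>s\<in>{0..1::real}. \<lambda>t \<in> topspace (cube j). g (t(j := s)) :: 'a)"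
  define D where "D = (\<lambda>G. \<lambda>t \<in> topspace (cube (Suc j)). G (t j) (t(j := 0)) :: 'a)"
  have gb: "g t = x" if "g \<in> topspace ?N" "t \<in> cube_boundary (Suc j)" for g t
    using that by (auto simp: topspace_nloop_space nloops_def)
  have cC: "continuous_map ?N ?L C"
  proof (rule continuous_map_into_loop_space)
    show "continuous_map (prod_topology ?N ?I) (nloop_space j X x) (\<lambda>(g, s). C g s)"
    proof (rule continuous_map_into_nloop_space)
      have "continuous_map (prod_topology (prod_topology ?N ?I) (cube j)) X
          (\<lambda>z. fst (fst z) ((snd z)(j := snd (fst z))))"
        by (rule continuous_map_nloop_eval[OF continuous_map_fst_comp[OF continuous_map_fst]
             continuous_map_cube_join[OF continuous_map_snd continuous_map_snd_comp[OF continuous_map_fst]]])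
      then show "continuous_map (prod_topology (prod_topology ?N ?I) (cube j)) X
          (\<lambda>(a, t). (case a of (g, s) \<Rightarrow> C g s) t)"
        by (rule continuous_map_eq) (auto simp: C_def)
      fix a assume a: "a \<in> topspace (prod_topology ?N ?I)"
      then show "(case a of (g, s) \<Rightarrow> C g s) \<in> extensional (topspace (cube j))"
        by (auto simp: C_def)
      show "(case a of (g, s) \<Rightarrow> C g s) t = x" if "t \<in> cube_boundary j" for t
      proof -
        have t: "t \<in> topspace (cube j)" using that cube_boundary_subset by blast
        then have "t(j := s) \<in> cube_boundary (Suc j)" if "s \<in> {0..1}" for s
          using that \<open>t \<in> cube_boundary j\<close> cube_boundary_Suc[OF cube_SucI[OF t that]] by simp
        then show ?thesis
          using a t gb by (auto simp: C_def)
      qed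
    qed
    fix g assume g: "g \<in> topspace ?N"
    have "C g s = ?c" if "s = 0 \<or> s = 1" for s
    proof -
      have "g (t(j := s)) = x" if t: "t \<in> topspace (cube j)" for t
        by (intro gb[OF g]) (use t \<open>s = 0 \<or> s = 1\<close> cube_boundary_Suc[OF cube_SucI[OF t, of s]] in auto)
      then show ?thesis using that by (auto simp: C_def)
    qed
    moreover have "C g \<in> extensional {0..1}" by (simp add: C_def)
    ultimately show "C g \<in> extensional {0..1} \<and> C g 0 = ?c \<and> C g 1 = ?c"
      by blast
  qed
  have Lb: "G s \<in> nloops j X x" if "G \<in> topspace ?L" "s \<in> {0..1}" for G s
    using that by (auto simp: topspace_loop_space continuous_map_def topspace_nloop_space)
  have cD: "continuous_map ?L ?N D"
  proof (rule continuous_map_into_nloop_space)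
    have "continuous_map (prod_topology ?L (cube (Suc j))) X
        (\<lambda>z. fst z (snd z j) ((snd z)(j := 0)))"
      by (rule continuous_map_nloop_eval[OF continuous_map_loop_eval[OF continuous_map_fst
            continuous_map_cube_coord01[OF continuous_map_snd lessI]]
            continuous_map_cube_init[OF continuous_map_snd]])
    then show "continuous_map (prod_topology ?L (cube (Suc j))) X (\<lambda>(G, t). D G t)"
      by (rule continuous_map_eq) (auto simp: D_def)
    fix G assume G: "G \<in> topspace ?L"
    show "D G \<in> extensional (topspace (cube (Suc j)))" by (simp add: D_def)
    show "D G t = x" if t: "t \<in> cube_boundary (Suc j)" for t
    proof -
      have t': "t \<in> topspace (cube (Suc j))" using t cube_boundary_subset by blast
      note tt = cube_SucD[OF t']
      consider "t(j := 0) \<in> cube_boundary j" | "t j = 0" | "t j = 1"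
        using t cube_boundary_Suc[OF t'] by blast
      then show ?thesis
      proof cases
        case 1
        then show ?thesis using Lb[OF G tt(2)] t' by (simp add: D_def nloops_def)
      qed (use G t' tt in \<open>auto simp: D_def topspace_loop_space\<close>)
    qed
  qed
  have "D (C g) = g" if "g \<in> topspace ?N" for g
  proof
    fix t show "D (C g) t = g t"
      using that cube_SucD[of t j] by (auto simp: D_def C_def topspace_nloop_space nloops_def extensional_def)
  qed
  moreover have "C (D G) = G" if G: "G \<in> topspace ?L" for G
  proof
    fix s show "C (D G) s = G s"
    proof (cases "s \<in> {0..1}")
      case False then show ?thesis using G by (auto simp: C_def topspace_loop_space extensional_def)
    next
      case True
      show ?thesis
      proof
        fix t show "C (D G) s t = G s t"
          using Lb[OF G True] True cube_SucI[of t j s] by (auto simp: D_def C_def nloops_def extensional_def)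
      qed
    qed
  qed
  ultimately have "homeomorphic_maps ?N ?L C D"
    using cC cD by (auto simp: homeomorphic_maps_def)
  then show ?thesis unfolding homeomorphic_space_def by blast
qed

section \<open>Fillable spaces and their loop spaces\<close>

text \<open>Cubes replace spheres because a cube times an interval is again a cube, which is what
  the passage to loop spaces needs. For \<open>k = 0\<close> the boundary is a pair of points, and
  the condition joins any two points of \<open>V\<close> by a path in \<open>U\<close>.\<close>

definition fillable :: "nat \<Rightarrow> 'a topology \<Rightarrow> bool"
  where "fillable k Y \<longleftrightarrow>
    (\<forall>y U. openin Y U \<and> y \<in> U \<longrightarrow>
      (\<exists>V. openin Y V \<and> y \<in> V \<and>
        (\<forall>f. continuous_map (subtopology (cube (Suc k)) (cube_boundary (Suc k))) (subtopology Y V) f \<longrightarrow>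
          (\<exists>F. continuous_map (cube (Suc k)) (subtopology Y U) F \<and>
            (\<forall>t \<in> cube_boundary (Suc k). F t = f t)))))"

lemma fillableE:
  assumes "fillable k Y" "openin Y U" "y \<in> U"
  obtains V where "openin Y V" "y \<in> V"
    "\<And>f. continuous_map (subtopology (cube (Suc k)) (cube_boundary (Suc k))) (subtopology Y V) f \<Longrightarrow>
          \<exists>F. continuous_map (cube (Suc k)) (subtopology Y U) F \<and>
            (\<forall>t \<in> cube_boundary (Suc k). F t = f t)"
  using assms(1)[unfolded fillable_def, rule_format, OF conjI[OF assms(2,3)]] by blast

lemma continuous_map_between_preimages:
  assumes "continuous_map Y Z f" "continuous_map W (subtopology Y {y \<in> topspace Y. f y \<in> U}) g"
  shows "continuous_map W (subtopology Z U) (f \<circ> g)"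
  using assms continuous_map_compose[OF _ assms(1), of W g]
  by (auto simp: continuous_map_in_subtopology)

lemma homeomorphic_fillable:
  assumes "fillable k Y" "Y homeomorphic_space Z"
  shows "fillable k Z"
  unfolding fillable_def
proof (intro allI impI, elim conjE)
  fix z U assume U: "openin Z U" "z \<in> U"
  let ?bd = "subtopology (cube (Suc k)) (cube_boundary (Suc k))"
  obtain f g where fg: "homeomorphic_maps Y Z f g"
    using assms(2) by (auto simp: homeomorphic_space_def)
  then have f: "continuous_map Y Z f" and g: "continuous_map Z Y g"
    and fg1: "\<And>z. z \<in> topspace Z \<Longrightarrow> f (g z) = z"
    by (auto simp: homeomorphic_maps_def)
  let ?U = "{y \<in> topspace Y. f y \<in> U}"
  have z: "z \<in> topspace Z" using U openin_subset by blast
  then have "g z \<in> ?U"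
    using continuous_map_funspace[OF g] U(2) fg1 by auto
  with assms(1) openin_continuous_map_preimage[OF f U(1)]
  obtain V where V: "openin Y V" "g z \<in> V"
    and fill: "\<And>h. continuous_map ?bd (subtopology Y V) h \<Longrightarrow>
      \<exists>F. continuous_map (cube (Suc k)) (subtopology Y ?U) F \<and> (\<forall>t \<in> cube_boundary (Suc k). F t = h t)"
    by (rule fillableE) blast
  let ?V = "{z \<in> topspace Z. g z \<in> V}"
  have "\<exists>F. continuous_map (cube (Suc k)) (subtopology Z U) F \<and> (\<forall>t \<in> cube_boundary (Suc k). F t = h t)"
    if h: "continuous_map ?bd (subtopology Z ?V) h" for h
  proof -
    obtain F where F: "continuous_map (cube (Suc k)) (subtopology Y ?U) F"
      "\<forall>t \<in> cube_boundary (Suc k). F t = (g \<circ> h) t"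
      using fill[OF continuous_map_between_preimages[OF g h]] by blast
    have "h t \<in> topspace Z" if "t \<in> cube_boundary (Suc k)" for t
      using continuous_map_funspace[OF h] that cube_boundary_subset by fastforce
    then show ?thesis
      using continuous_map_between_preimages[OF f F(1)] F(2) fg1 by (intro exI[of _ "f \<circ> F"]) auto
  qed
  then show "\<exists>V. openin Z V \<and> z \<in> V \<and> (\<forall>h. continuous_map ?bd (subtopology Z V) h \<longrightarrow>
          (\<exists>F. continuous_map (cube (Suc k)) (subtopology Z U) F \<and> (\<forall>t \<in> cube_boundary (Suc k). F t = h t)))"
    using openin_continuous_map_preimage[OF g V(1)] V(2) z by (intro exI[of _ ?V]) blast
qed

lemma closedin_cube_boundary: "closedin (cube n) (cube_boundary n)"
proof -
  have "closedin (cube n) {t \<in> topspace (cube n). t i \<in> {0, 1}}" for i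
    by (rule closedin_continuous_map_preimage[OF continuous_map_cube_coord])
       (auto intro: continuous_map_id[unfolded id_def])
  moreover have "cube_boundary n = (\<Union>i<n. {t \<in> topspace (cube n). t i \<in> {0, 1}})"
    by (auto simp: cube_boundary_def)
  ultimately show ?thesis
    by (auto intro!: closedin_Union)
qed

section \<open>Neighbourhoods given by finitely many constraints\<close>

text \<open>Induction over the generation of the open set: for an intersection the two constraint
  lists are united, and for a union the list of one member containing \<open>f\<close> is kept. The
  constraints in the list are those which a filling must respect later.\<close>

lemma compact_open_neighbourhood:
  assumes "openin (compact_open_topology B X) U" "f \<in> U"
  obtains \<L> where "finite \<L>"
    "\<And>K W. (K, W) \<in> \<L> \<Longrightarrow> compactin B K \<and> openin X W \<and> f ` K \<subseteq> W"
    "\<And>g. g \<in> topspace (compact_open_topology B X) \<Longrightarrow> (\<And>K W. (K, W) \<in> \<L> \<Longrightarrow> g ` K \<subseteq> W) \<Longrightarrow> g \<in> U"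
proof -
  let ?T = "topspace (compact_open_topology B X)"
  define Q where "Q = (\<lambda>u \<L>. finite \<L> \<and>
    (\<forall>p \<in> \<L>. compactin B (fst p) \<and> openin X (snd p) \<and> f ` fst p \<subseteq> snd p) \<and>
    (\<forall>g \<in> ?T. (\<forall>p \<in> \<L>. g ` fst p \<subseteq> snd p) \<longrightarrow> g \<in> u))"
  have "generate_topology_on {{f \<in> extensional (topspace B). continuous_map B X f \<and> f ` K \<subseteq> U} | K U.
         compactin B K \<and> openin X U} U"
    using assms(1) unfolding compact_open_topology_def openin_topology_generated_by_iff .
  then have "\<exists>\<L>. Q U \<L>"
    using assms(2)
  proof (induction rule: generate_topology_on.induct)
    case (Int a b)
    then have "f \<in> a" "f \<in> b" by auto
    with Int.IH obtain \<L> \<L>' where "Q a \<L>" "Q b \<L>'" by blast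
    then have "Q (a \<inter> b) (\<L> \<union> \<L>')" by (simp add: Q_def ball_Un)
    then show ?case by blast
  next
    case (UN \<K>)
    then obtain k where k: "k \<in> \<K>" "f \<in> k" by blast
    with UN.IH obtain \<L> where "Q k \<L>" by blast
    then have "Q (\<Union> \<K>) \<L>" unfolding Q_def using k(1) by blast
    then show ?case by blast
  next
    case (Basis s)
    then obtain K W where KW: "compactin B K" "openin X W"
      and s: "s = {f \<in> extensional (topspace B). continuous_map B X f \<and> f ` K \<subseteq> W}" by blast
    have "Q s {(K, W)}"
      using KW Basis.prems by (simp add: s Q_def topspace_compact_open_topology)
    then show ?case by blast
  qed simp
  then obtain \<L> where Q: "Q U \<L>" by blast
  show ?thesis
  proof (rule that[of \<L>])
    show "finite \<L>" using Q by (simp add: Q_def)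
    show "compactin B K \<and> openin X W \<and> f ` K \<subseteq> W" if "(K, W) \<in> \<L>" for K W
      using Q that unfolding Q_def by fastforce
    show "g \<in> U" if "g \<in> ?T" "\<And>K W. (K, W) \<in> \<L> \<Longrightarrow> g ` K \<subseteq> W" for g
    proof -
      have "\<forall>p \<in> \<L>. g ` fst p \<subseteq> snd p" using that(2) by auto
      then show ?thesis using Q that(1) unfolding Q_def by blast
    qed
  qed
qed

lemma openin_loop_space_subbase:
  assumes "K \<subseteq> {0..1}" "compact K" "openin Y U"
  shows "openin (loop_space Y y) {g \<in> topspace (loop_space Y y). g ` K \<subseteq> U}"
proof -
  have "compactin (top_of_set {0..1}) K" using assms by (simp add: compactin_subtopology)
  from openin_compact_open_subbase[OF this assms(3)]
  have "openin (loop_space Y y) ({f \<in> extensional {0..1}. continuous_map (top_of_set {0..1}) Y f \<and> f ` K \<subseteq> U}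
     \<inter> {f. f 0 = y \<and> f 1 = y})"
    unfolding loop_space_def by (simp add: openin_subtopology_Int)
  also have "({f \<in> extensional {0..1}. continuous_map (top_of_set {0..1}) Y f \<and> f ` K \<subseteq> U}
     \<inter> {f. f 0 = y \<and> f 1 = y}) = {g \<in> topspace (loop_space Y y). g ` K \<subseteq> U}"
    by (auto simp: topspace_loop_space)
  finally show ?thesis .
qed

lemma loop_space_neighbourhood:
  assumes "openin (loop_space Y y) U" "f \<in> U"
  obtains \<L> where "finite \<L>"
    "\<And>K W. (K, W) \<in> \<L> \<Longrightarrow> K \<subseteq> {0..1} \<and> compact K \<and> openin Y W \<and> f ` K \<subseteq> W"
    "\<And>g. g \<in> topspace (loop_space Y y) \<Longrightarrow> (\<And>K W. (K, W) \<in> \<L> \<Longrightarrow> g ` K \<subseteq> W) \<Longrightarrow> g \<in> U"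
proof -
  obtain T where T: "openin (compact_open_topology (top_of_set {0..1}) Y) T"
    "U = T \<inter> {f. f 0 = y \<and> f 1 = y}"
    using assms(1) unfolding loop_space_def openin_subtopology by blast
  then have "f \<in> T" using assms(2) by simp
  from T(1) this obtain \<L> where L: "finite \<L>"
    "\<And>K W. (K, W) \<in> \<L> \<Longrightarrow> compactin (top_of_set {0..1}) K \<and> openin Y W \<and> f ` K \<subseteq> W"
    "\<And>g. g \<in> topspace (compact_open_topology (top_of_set {0..1}) Y) \<Longrightarrow>
       (\<And>K W. (K, W) \<in> \<L> \<Longrightarrow> g ` K \<subseteq> W) \<Longrightarrow> g \<in> T"
    by (rule compact_open_neighbourhood) blast
  show ?thesis
  proof (rule that[OF L(1)])
    show "K \<subseteq> {0..1} \<and> compact K \<and> openin Y W \<and> f ` K \<subseteq> W" if "(K, W) \<in> \<L>" for K W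
      using L(2)[OF that] unfolding compactin_subtopology by simp
    show "g \<in> U" if "g \<in> topspace (loop_space Y y)" "\<And>K W. (K, W) \<in> \<L> \<Longrightarrow> g ` K \<subseteq> W" for g
    proof -
      have "g \<in> topspace (compact_open_topology (top_of_set {0..1}) Y)" "g 0 = y \<and> g 1 = y"
        using that(1) by (auto simp: loop_space_def)
      then show ?thesis using L(3)[of g] that(2) unfolding T(2) by blast
    qed
  qed
qed

section \<open>Filling slabs and gluing them along the loop parameter\<close>

text \<open>\<open>h\<close> is a map from the boundary of the \<open>m\<close>-cube to loops in \<open>V\<close>, uncurried; the faces of the slab
  \<open>cube m \<times> {a..b}\<close> carry \<open>\<phi>\<close> at \<open>a\<close> and \<open>\<psi>\<close> at \<open>b\<close>. Fillings are taken on the whole real line so that they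
  can be pasted without restricting domains, but only their values over \<open>{a..b}\<close> matter.\<close>

definition slab_data ::
    "nat \<Rightarrow> 'a topology \<Rightarrow> 'a set \<Rightarrow> 'a set \<Rightarrow> (real \<Rightarrow> 'a) set \<Rightarrow> real \<Rightarrow> real \<Rightarrow>
      ((nat \<Rightarrow> real) \<Rightarrow> real \<Rightarrow> 'a) \<Rightarrow> ((nat \<Rightarrow> real) \<Rightarrow> 'a) \<Rightarrow> ((nat \<Rightarrow> real) \<Rightarrow> 'a) \<Rightarrow> bool"
  where "slab_data m Y A B V a b h \<phi> \<psi> \<longleftrightarrow>
    continuous_map (prod_topology (subtopology (cube m) (cube_boundary m)) (top_of_set {0..1})) Y
      (\<lambda>p. h (fst p) (snd p)) \<and>
    (\<forall>t \<in> cube_boundary m. h t \<in> V \<and> \<phi> t = h t a \<and> \<psi> t = h t b) \<and>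
    continuous_map (cube m) (subtopology Y A) \<phi> \<and> continuous_map (cube m) (subtopology Y B) \<psi>"

definition slab_filling ::
    "nat \<Rightarrow> 'a topology \<Rightarrow> (real set \<times> 'a set) set \<Rightarrow> real \<Rightarrow> real \<Rightarrow>
      ((nat \<Rightarrow> real) \<Rightarrow> real \<Rightarrow> 'a) \<Rightarrow> ((nat \<Rightarrow> real) \<Rightarrow> 'a) \<Rightarrow> ((nat \<Rightarrow> real) \<Rightarrow> 'a) \<Rightarrow>
      ((nat \<Rightarrow> real) \<Rightarrow> real \<Rightarrow> 'a) \<Rightarrow> bool"
  where "slab_filling m Y \<L> a b h \<phi> \<psi> H \<longleftrightarrow>
    continuous_map (prod_topology (cube m) euclideanreal) Y (\<lambda>p. H (fst p) (snd p)) \<and>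
    (\<forall>t \<in> cube_boundary m. \<forall>s \<in> {a..b}. H t s = h t s) \<and>
    (\<forall>t \<in> topspace (cube m). H t a = \<phi> t \<and> H t b = \<psi> t) \<and>
    (\<forall>t \<in> topspace (cube m). \<forall>s \<in> {a..b}. \<forall>p \<in> \<L>. s \<in> fst p \<longrightarrow> H t s \<in> snd p)"

text \<open>The order of quantifiers is the point: \<open>A\<close>, \<open>B\<close> and
  \<open>V\<close> depend on \<open>f\<close>, the slab and the constraints, never on the data to be
  filled. \<open>V\<close> confines the loops on the side wall, whereas \<open>A\<close> and
  \<open>B\<close> confine the end faces, which extend over the interior of the cube as
  well.\<close>

definition slab_fillable ::
    "nat \<Rightarrow> 'a topology \<Rightarrow> 'a \<Rightarrow> (real \<Rightarrow> 'a) \<Rightarrow> (real set \<times> 'a set) set \<Rightarrow> real \<Rightarrow> real \<Rightarrow> bool"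
  where "slab_fillable m Y y f \<L> a b \<longleftrightarrow>
    (\<exists>A B V. openin Y A \<and> openin Y B \<and> f a \<in> A \<and> f b \<in> B \<and> openin (loop_space Y y) V \<and> f \<in> V \<and>
      (\<forall>h \<phi> \<psi>. slab_data m Y A B V a b h \<phi> \<psi> \<longrightarrow> (\<exists>H. slab_filling m Y \<L> a b h \<phi> \<psi> H)))"

text \<open>The strict inequalities cannot be dropped: over a degenerate slab \<open>\<phi>\<close> and \<open>\<psi>\<close> would have to agree.\<close>

lemma slab_fillable_trans:
  assumes k: "fillable k Y" and f: "f \<in> topspace (loop_space Y y)"
    and ab: "slab_fillable (Suc k) Y y f \<L> a b" and bc: "slab_fillable (Suc k) Y y f \<L> b c"
    and abc: "0 \<le> a" "a < b" "b < c" "c \<le> 1"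
  shows "slab_fillable (Suc k) Y y f \<L> a c"
proof -
  let ?C = "cube (Suc k)" and ?bd = "cube_boundary (Suc k)" and ?I = "top_of_set {0..1::real}"
  obtain A B V where 1: "openin Y A" "openin Y B" "f a \<in> A" "f b \<in> B" "openin (loop_space Y y) V" "f \<in> V"
    and fill1: "\<And>h \<phi> \<psi>. slab_data (Suc k) Y A B V a b h \<phi> \<psi> \<Longrightarrow> \<exists>H. slab_filling (Suc k) Y \<L> a b h \<phi> \<psi> H"
    using ab unfolding slab_fillable_def by blast
  obtain A' B' V' where 2: "openin Y A'" "openin Y B'" "f b \<in> A'" "f c \<in> B'" "openin (loop_space Y y) V'" "f \<in> V'"
    and fill2: "\<And>h \<phi> \<psi>. slab_data (Suc k) Y A' B' V' b c h \<phi> \<psi> \<Longrightarrow> \<exists>H. slab_filling (Suc k) Y \<L> b c h \<phi> \<psi> H"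
    using bc unfolding slab_fillable_def by blast
  have "openin Y (B \<inter> A')" "f b \<in> B \<inter> A'" using 1 2 by auto
  \<comment> \<open>The two fillings must agree over \<open>b\<close>, so the common face is filled inside both neighbourhoods.\<close>
  with k obtain N where N: "openin Y N" "f b \<in> N"
    and fillN: "\<And>g. continuous_map (subtopology ?C ?bd) (subtopology Y N) g \<Longrightarrow>
          \<exists>F. continuous_map ?C (subtopology Y (B \<inter> A')) F \<and> (\<forall>t \<in> ?bd. F t = g t)"
    by (rule fillableE) blast
  \<comment> \<open>Membership in \<open>?N\<close> keeps the boundary loops inside \<open>N\<close>
    at time \<open>b\<close>, as filling the common face requires.\<close>
  let ?N = "{g \<in> topspace (loop_space Y y). g ` {b} \<subseteq> N}"
  have N': "openin (loop_space Y y) ?N"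
    by (rule openin_loop_space_subbase) (use abc N in auto)
  have "\<exists>H. slab_filling (Suc k) Y \<L> a c h \<phi> \<psi> H"
    if data: "slab_data (Suc k) Y A B' (V \<inter> V' \<inter> ?N) a c h \<phi> \<psi>" for h \<phi> \<psi>
  proof -
    have h: "continuous_map (prod_topology (subtopology ?C ?bd) ?I) Y (\<lambda>p. h (fst p) (snd p))"
      and hV: "\<forall>t \<in> ?bd. h t \<in> V \<inter> V' \<inter> ?N \<and> \<phi> t = h t a \<and> \<psi> t = h t c"
      and \<phi>: "continuous_map ?C (subtopology Y A) \<phi>" and \<psi>: "continuous_map ?C (subtopology Y B') \<psi>"
      using data unfolding slab_data_def by simp_all
    have "continuous_map (subtopology ?C ?bd) (prod_topology (subtopology ?C ?bd) ?I) (\<lambda>t. (t, b))"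
      using abc by (intro continuous_map_pairedI) (auto intro: continuous_map_id[unfolded id_def])
    from continuous_map_compose[OF this h]
    have "continuous_map (subtopology ?C ?bd) Y (\<lambda>t. h t b)" by (simp add: o_def)
    then have "continuous_map (subtopology ?C ?bd) (subtopology Y N) (\<lambda>t. h t b)"
      using hV by (auto simp: continuous_map_in_subtopology)
    from fillN[OF this] obtain \<xi> where \<xi>: "continuous_map ?C (subtopology Y (B \<inter> A')) \<xi>"
      and \<xi>h: "\<forall>t \<in> ?bd. \<xi> t = h t b" by blast
    have \<xi>1: "continuous_map ?C (subtopology Y B) \<xi>" "continuous_map ?C (subtopology Y A') \<xi>"
      using \<xi> by (auto simp: continuous_map_in_subtopology)
    have "slab_data (Suc k) Y A B V a b h \<phi> \<xi>"
      unfolding slab_data_def using h hV \<phi> \<xi>1(1) \<xi>h by simp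
    from fill1[OF this] obtain H1 where H1: "continuous_map (prod_topology ?C euclideanreal) Y (\<lambda>p. H1 (fst p) (snd p))"
          "\<forall>t \<in> ?bd. \<forall>s \<in> {a..b}. H1 t s = h t s"
          "\<forall>t \<in> topspace ?C. H1 t a = \<phi> t \<and> H1 t b = \<xi> t"
          "\<forall>t \<in> topspace ?C. \<forall>s \<in> {a..b}. \<forall>p \<in> \<L>. s \<in> fst p \<longrightarrow> H1 t s \<in> snd p"
      unfolding slab_filling_def by (elim exE conjE)
    have "slab_data (Suc k) Y A' B' V' b c h \<xi> \<psi>"
      unfolding slab_data_def using h hV \<psi> \<xi>1(2) \<xi>h by simp
    from fill2[OF this] obtain H2 where H2: "continuous_map (prod_topology ?C euclideanreal) Y (\<lambda>p. H2 (fst p) (snd p))"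
          "\<forall>t \<in> ?bd. \<forall>s \<in> {b..c}. H2 t s = h t s"
          "\<forall>t \<in> topspace ?C. H2 t b = \<xi> t \<and> H2 t c = \<psi> t"
          "\<forall>t \<in> topspace ?C. \<forall>s \<in> {b..c}. \<forall>p \<in> \<L>. s \<in> fst p \<longrightarrow> H2 t s \<in> snd p"
      unfolding slab_filling_def by (elim exE conjE)
    define H where "H = (\<lambda>t s. if s \<le> b then H1 t s else H2 t s)"
    have snd: "continuous_map (prod_topology ?C euclideanreal) euclideanreal (\<lambda>p. snd p)"
      by (rule continuous_map_snd)
    have "continuous_map (prod_topology ?C euclideanreal) Y
        (\<lambda>p. if snd p \<le> b then H1 (fst p) (snd p) else H2 (fst p) (snd p))"
    proof (rule continuous_map_cases_le[OF snd _ continuous_map_from_subtopology[OF H1(1)]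
          continuous_map_from_subtopology[OF H2(1)]])
      fix p assume "p \<in> topspace (prod_topology ?C euclideanreal)" "snd p = b"
      then show "H1 (fst p) (snd p) = H2 (fst p) (snd p)" using H1(3) H2(3) by auto
    qed simp
    then have "continuous_map (prod_topology ?C euclideanreal) Y (\<lambda>p. H (fst p) (snd p))"
      by (simp add: H_def)
    moreover have "\<forall>t \<in> ?bd. \<forall>s \<in> {a..c}. H t s = h t s"
      using H1(2) H2(2) by (auto simp: H_def)
    moreover have "\<forall>t \<in> topspace ?C. H t a = \<phi> t \<and> H t c = \<psi> t"
      using H1(3) H2(3) abc by (auto simp: H_def)
    moreover have "\<forall>t \<in> topspace ?C. \<forall>s \<in> {a..c}. \<forall>p \<in> \<L>. s \<in> fst p \<longrightarrow> H t s \<in> snd p"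
      using H1(4) H2(4) by (simp add: H_def)
    ultimately show ?thesis unfolding slab_filling_def by blast
  qed
  moreover have "openin (loop_space Y y) (V \<inter> V' \<inter> ?N)" "f \<in> V \<inter> V' \<inter> ?N"
    using 1 2 N N' f by auto
  ultimately show ?thesis
    unfolding slab_fillable_def using 1(1,3) 2(2,4) by blast
qed

lemma openin_unit_interval_ball:
  assumes "openin (top_of_set {0..1::real}) N" "x \<in> N"
  obtains d where "d > 0" "\<And>s. s \<in> {0..1} \<Longrightarrow> \<bar>s - x\<bar> < d \<Longrightarrow> s \<in> N"
  using assms unfolding openin_euclidean_subtopology_iff dist_real_def by metis

text \<open>Constraints whose compact set contains \<open>x\<close> merge into one open set
  \<open>U\<close> around \<open>f x\<close>. The other compact sets form a closed set missing
  \<open>x\<close>, so on a short interval around \<open>x\<close> their constraints are vacuous. It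
  then suffices to fill the whole boundary of the slab inside \<open>U\<close>, a single use of
  fillability in dimension \<open>Suc k\<close>.\<close>

lemma slab_fillable_local:
  assumes k: "fillable (Suc k) Y" and f: "f \<in> topspace (loop_space Y y)" and x: "x \<in> {0..1}"
    and \<L>: "finite \<L>" "\<And>K W. (K, W) \<in> \<L> \<Longrightarrow> K \<subseteq> {0..1} \<and> compact K \<and> openin Y W \<and> f ` K \<subseteq> W"
  obtains d where "d > 0"
    "\<And>a b. \<lbrakk>0 \<le> a; a \<le> x; x \<le> b; b \<le> 1; a < b; b - a < d\<rbrakk> \<Longrightarrow> slab_fillable (Suc k) Y y f \<L> a b"
proof -
  let ?m = "Suc k" and ?I = "top_of_set {0..1::real}"
  let ?C = "cube ?m" and ?bd = "cube_boundary ?m"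
  let ?E = "cube (Suc ?m)" and ?D = "cube_boundary (Suc ?m)"
  have fc: "continuous_map ?I Y f" using f by (simp add: topspace_loop_space)
  have fx: "f x \<in> topspace Y" using continuous_map_funspace[OF fc] x by auto
  have L: "fst p \<subseteq> {0..1} \<and> compact (fst p) \<and> openin Y (snd p) \<and> f ` fst p \<subseteq> snd p" if "p \<in> \<L>" for p
    using \<L>(2)[of "fst p" "snd p"] that by simp
  define \<W> where "\<W> = snd ` {p \<in> \<L>. x \<in> fst p}"
  \<comment> \<open>Intersecting with \<open>topspace Y\<close> covers the case without constraints,
    in which the intersection of \<open>\<W>\<close> is the whole type.\<close>
  define U where "U = topspace Y \<inter> \<Inter> \<W>"
  have W: "openin Y W \<and> f x \<in> W" if "W \<in> \<W>" for W
    using that L x by (force simp: \<W>_def)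
  have "finite \<W>" using \<L>(1) by (simp add: \<W>_def)
  then have "openin Y U"
    unfolding U_def using W by (cases "\<W> = {}") (auto intro: openin_Int openin_Inter)
  moreover have "f x \<in> U" using fx W by (auto simp: U_def)
  ultimately obtain V0 where V0: "openin Y V0" "f x \<in> V0"
    and fill: "\<And>g. continuous_map (subtopology ?E ?D) (subtopology Y V0) g \<Longrightarrow>
          \<exists>F. continuous_map ?E (subtopology Y U) F \<and> (\<forall>t \<in> ?D. F t = g t)"
    using fillableE[OF k] by metis
  define \<K> where "\<K> = fst ` {p \<in> \<L>. x \<notin> fst p}"
  have \<K>: "compact K" "x \<notin> K" if "K \<in> \<K>" for K
    using that L by (auto simp: \<K>_def)
  have fin: "finite \<K>" using \<L>(1) by (simp add: \<K>_def)
  have "closed (\<Union> \<K>)" using fin \<K>(1) by (intro closed_Union) (auto intro: compact_imp_closed)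
  then have "openin ?I ({0..1} \<inter> - \<Union> \<K>)" by (intro openin_open_Int) auto
  then have "openin ?I ({s \<in> topspace ?I. f s \<in> V0} \<inter> ({0..1} \<inter> - \<Union> \<K>))"
    using openin_continuous_map_preimage[OF fc V0(1)] by (rule openin_Int[rotated])
  moreover have "x \<in> {s \<in> topspace ?I. f s \<in> V0} \<inter> ({0..1} \<inter> - \<Union> \<K>)"
    using x V0 \<K>(2) by auto
  ultimately obtain d where d: "d > 0"
    "\<And>s. s \<in> {0..1} \<Longrightarrow> \<bar>s - x\<bar> < d \<Longrightarrow> s \<in> {s \<in> topspace ?I. f s \<in> V0} \<inter> ({0..1} \<inter> - \<Union> \<K>)"
    by (rule openin_unit_interval_ball) blast
  show ?thesis
  proof (rule that[OF d(1)])
    fix a b assume ab: "0 \<le> a" "a \<le> x" "x \<le> b" "b \<le> 1" "a < b" "b - a < d"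
    have near: "f s \<in> V0" "s \<notin> \<Union> \<K>" if "s \<in> {a..b}" for s
      using d(2)[of s] that ab by auto
    let ?V = "{g \<in> topspace (loop_space Y y). g ` {a..b} \<subseteq> V0}"
    have V: "openin (loop_space Y y) ?V" "f \<in> ?V"
      using openin_loop_space_subbase[of "{a..b}", OF _ _ V0(1)] ab near f by auto
    have "\<exists>H. slab_filling ?m Y \<L> a b h \<phi> \<psi> H"
      if data: "slab_data ?m Y V0 V0 ?V a b h \<phi> \<psi>" for h \<phi> \<psi>
    proof -
      have h: "continuous_map (prod_topology (subtopology ?C ?bd) ?I) Y (\<lambda>p. h (fst p) (snd p))"
        and hV: "\<And>t. t \<in> ?bd \<Longrightarrow> h t \<in> ?V \<and> \<phi> t = h t a \<and> \<psi> t = h t b"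
        and \<phi>: "continuous_map ?C (subtopology Y V0) \<phi>" and \<psi>: "continuous_map ?C (subtopology Y V0) \<psi>"
        using data unfolding slab_data_def by simp_all
      let ?S = "subtopology ?E ?D"
      \<comment> \<open>The bottom lid, the top lid and the side wall of \<open>?E\<close>, whose
        last coordinate has index \<open>?m\<close>. On the wall, \<open>G 2\<close> stretches that
        coordinate from \<open>{0..1}\<close> to \<open>{a..b}\<close>.\<close>
      define T where "T = (\<lambda>i::nat. if i = 0 then {t \<in> ?D. t ?m = 0}
        else if i = 1 then {t \<in> ?D. t ?m = 1} else {t \<in> ?D. t(?m := 0) \<in> ?bd})"
      define G where "G = (\<lambda>i::nat. if i = 0 then (\<lambda>t. \<phi> (t(?m := 0)))
        else if i = 1 then (\<lambda>t. \<psi> (t(?m := 0))) else (\<lambda>t. h (t(?m := 0)) (a + (b - a) * t ?m)))"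
      define g where "g = (\<lambda>t. if t ?m = 0 then G 0 t else if t ?m = 1 then G 1 t else G 2 t)"
      have idE: "continuous_map ?E ?E (\<lambda>t. t)" using continuous_map_id[unfolded id_def] .
      have idS: "continuous_map ?S ?E (\<lambda>t. t)"
        using idE by (rule continuous_map_from_subtopology)
      have topS: "topspace ?S = ?D" using cube_boundary_subset by auto
      have S3: "?D \<subseteq> T 0 \<union> T 1 \<union> T 2"
        using cube_boundary_Suc[of _ ?m] cube_boundary_subset[of "Suc ?m"] by (auto simp: T_def)
      have clo: "closedin ?S (T i)" for i
      proof -
        have "closedin ?S {t \<in> topspace ?S. t ?m \<in> {c}}" for c
          by (rule closedin_continuous_map_preimage[OF continuous_map_cube_coord[OF idS]]) auto
        moreover have "closedin ?S {t \<in> topspace ?S. t(?m := 0) \<in> ?bd}"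
          by (rule closedin_continuous_map_preimage[OF continuous_map_cube_init[OF idS] closedin_cube_boundary])
        ultimately show ?thesis unfolding topS by (simp add: T_def)
      qed
      have c0: "continuous_map (subtopology ?S A) (subtopology Y V0) (\<lambda>t. \<theta> (t(?m := 0)))"
        if "continuous_map ?C (subtopology Y V0) \<theta>" for A \<theta>
        using continuous_map_compose[OF continuous_map_from_subtopology[OF continuous_map_cube_init[OF idS]] that]
        by (simp add: o_def)
      have c2: "continuous_map (subtopology ?S (T 2)) (subtopology Y V0) (G 2)"
      proof -
        let ?Z = "subtopology ?S (T 2)"
        have idZ: "continuous_map ?Z ?E (\<lambda>t. t)"
          using idS by (rule continuous_map_from_subtopology)
        have r01: "a + (b - a) * u \<in> {a..b}" if "u \<in> {0..1}" for u
        proof -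
          have "(b - a) * u \<le> (b - a) * 1" by (rule mult_left_mono) (use that ab in auto)
          moreover have "0 \<le> (b - a) * u" using that ab by simp
          ultimately show ?thesis by simp
        qed
        have top2: "t(?m := 0) \<in> ?bd \<and> t ?m \<in> {0..1}" if "t \<in> topspace ?Z" for t
        proof -
          have "t \<in> T 2" "t \<in> topspace ?E" using that by auto
          then show ?thesis using cube_SucD(2) by (simp add: T_def)
        qed
        have 1: "continuous_map ?Z (subtopology ?C ?bd) (\<lambda>t. t(?m := 0))"
          unfolding continuous_map_in_subtopology using continuous_map_cube_init[OF idZ] top2 by auto
        have "continuous_map ?Z euclideanreal (\<lambda>t. a + (b - a) * t ?m)"
          by (intro continuous_intros continuous_map_cube_coord[OF idZ])
        moreover have "(\<lambda>t. a + (b - a) * t ?m) \<in> topspace ?Z \<rightarrow> {0..1}"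
          using r01 top2 ab by fastforce
        ultimately have 2: "continuous_map ?Z ?I (\<lambda>t. a + (b - a) * t ?m)"
          unfolding continuous_map_in_subtopology by blast
        have "continuous_map ?Z Y (G 2)"
          using continuous_map_compose[OF continuous_map_pairedI[OF 1 2] h] by (simp add: o_def G_def)
        moreover have "G 2 t \<in> V0" if "t \<in> topspace ?Z" for t
          using hV[of "t(?m := 0)"] top2[OF that] r01[of "t ?m"] by (auto simp: G_def)
        ultimately show ?thesis unfolding continuous_map_in_subtopology by blast
      qed
      have "continuous_map ?S (subtopology Y V0) g"
      proof (rule pasting_lemma_closed[of "{0,1,2}" _ T _ G])
        show "closedin ?S (T i)" for i by (rule clo)
        show "continuous_map (subtopology ?S (T i)) (subtopology Y V0) (G i)" if "i \<in> {0,1,2}" for i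
          using that c0[OF \<phi>] c0[OF \<psi>] c2 by (auto simp: G_def)
        show "G i t = G j t" if "i \<in> {0,1,2}" "j \<in> {0,1,2}" "t \<in> topspace ?S \<inter> T i \<inter> T j" for i j t
          using that hV[of "t(?m := 0)"] by (auto simp: G_def T_def split: if_splits)
        show "\<exists>j. j \<in> {0,1,2} \<and> t \<in> T j \<and> g t = G j t" if "t \<in> topspace ?S" for t
        proof -
          have t: "t \<in> ?D" using that by simp
          consider "t ?m = 0" | "t ?m = 1" | "t ?m \<noteq> 0" "t ?m \<noteq> 1" by blast
          then show ?thesis
          proof cases
            case 1 then show ?thesis using t by (intro exI[of _ 0]) (simp add: T_def g_def)
          next
            case 2 then show ?thesis using t by (intro exI[of _ 1]) (simp add: T_def g_def)
          next
            case 3 then have "t \<in> T 2" using t S3 by (auto simp: T_def)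
            then show ?thesis using 3 by (intro exI[of _ 2]) (simp add: g_def)
          qed
        qed
      qed simp
      from fill[OF this] obtain F where F: "continuous_map ?E (subtopology Y U) F"
        and Fg: "\<And>t. t \<in> ?D \<Longrightarrow> F t = g t" by blast
      \<comment> \<open>The inverse of the stretching, clamped to \<open>{0..1}\<close>: this makes
        \<open>H\<close> continuous over the whole line, constant in \<open>s\<close> to the left of
        \<open>a\<close> and to the right of \<open>b\<close>.\<close>
      define c where "c = (\<lambda>s. max 0 (min 1 ((s - a) / (b - a))))"
      define H where "H = (\<lambda>t s. F (t(?m := c s)))"
      have c01: "c s \<in> {0..1}" for s by (simp add: c_def)
      have ca: "c a = 0" "c b = 1" using ab by (simp_all add: c_def)
      have cs: "a + (b - a) * c s = s" if "s \<in> {a..b}" for s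
        using that ab by (auto simp: c_def min_def max_def field_simps)
      have Hval: "F t \<in> U" if "t \<in> topspace ?E" for t
        using continuous_map_funspace[OF F] that by auto
      have Hc: "continuous_map (prod_topology ?C euclideanreal) Y (\<lambda>p. H (fst p) (snd p))"
      proof -
        have snd: "continuous_map (prod_topology ?C euclideanreal) euclideanreal (\<lambda>p. snd p)"
          by (rule continuous_map_snd)
        have "continuous_map (prod_topology ?C euclideanreal) euclideanreal (\<lambda>p. c (snd p))"
          unfolding c_def
          by (intro continuous_map_real_max continuous_map_real_min continuous_map_real_divide
               continuous_map_diff continuous_map_canonical_const snd) (use ab in auto)
        then have "continuous_map (prod_topology ?C euclideanreal) ?I (\<lambda>p. c (snd p))"
          using c01 by (auto simp: continuous_map_in_subtopology)
        from continuous_map_compose[OF continuous_map_cube_join[OF continuous_map_fst this] F]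
        show ?thesis by (simp add: o_def H_def continuous_map_in_subtopology)
      qed
      have Hb: "H t s = g (t(?m := c s))" if "t \<in> topspace ?C" "t \<in> ?bd \<or> c s = 0 \<or> c s = 1" for t s
        unfolding H_def
        by (intro Fg) (use that c01 cube_boundary_Suc[OF cube_SucI[OF that(1) c01]] in auto)
      have "\<forall>t \<in> ?bd. \<forall>s \<in> {a..b}. H t s = h t s"
      proof (intro ballI)
        fix t s assume t: "t \<in> ?bd" and s: "s \<in> {a..b}"
        then have t': "t \<in> topspace ?C" using cube_boundary_subset by blast
        then have tr: "t(?m := 0) = t" by simp
        \<comment> \<open>On the rim, \<open>g\<close> takes its value from a lid before it
          considers the wall. There \<open>s\<close> is \<open>a\<close> or \<open>b\<close>, where
          \<open>\<phi>\<close> and \<open>\<psi>\<close> agree with \<open>h\<close>.\<close>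
        have "c s = 0 \<Longrightarrow> s = a" "c s = 1 \<Longrightarrow> s = b" using cs[OF s] by auto
        then show "H t s = h t s"
          using Hb[OF t', of s] t hV[OF t] cs[OF s] tr by (simp add: g_def G_def split: if_splits)
      qed
      moreover have "\<forall>t \<in> topspace ?C. H t a = \<phi> t \<and> H t b = \<psi> t"
      proof
        fix t assume t: "t \<in> topspace ?C"
        then have "t ?m = 0" by (simp add: topspace_cube)
        then show "H t a = \<phi> t \<and> H t b = \<psi> t"
          using Hb[OF t, of a] Hb[OF t, of b] ca t by (simp add: g_def G_def)
      qed
      moreover have "\<forall>t \<in> topspace ?C. \<forall>s \<in> {a..b}. \<forall>p \<in> \<L>. s \<in> fst p \<longrightarrow> H t s \<in> snd p"
      proof (intro ballI impI)
        fix t s p assume *: "t \<in> topspace ?C" "s \<in> {a..b}" "p \<in> \<L>" "s \<in> fst p"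
        have "x \<in> fst p"
        proof (rule ccontr)
          assume "x \<notin> fst p"
          then have "fst p \<in> \<K>" using *(3) by (simp add: \<K>_def)
          then show False using near(2)[OF *(2)] *(4) by blast
        qed
        then have "snd p \<in> \<W>" using *(3) by (simp add: \<W>_def)
        moreover have "H t s \<in> U" unfolding H_def by (intro Hval cube_SucI c01 *)
        ultimately show "H t s \<in> snd p" by (auto simp: U_def)
      qed
      ultimately show ?thesis using Hc unfolding slab_filling_def by blast
    qed
    then show "slab_fillable ?m Y y f \<L> a b"
      unfolding slab_fillable_def using V V0(1) near(1)[of a] near(1)[of b] ab
      by (intro exI[of _ V0] exI[of _ ?V]) simp
  qed
qed

text \<open>The loop parameter becomes the interval direction of a slab. A filling over
  \<open>{0..1}\<close> with constant end faces is, after currying, a map from the cube into loops,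
  and respecting the constraints \<open>\<L>\<close> means that it stays in
  \<open>U\<close>.\<close>

lemma fillable_loop_space:
  assumes k: "fillable k Y" "fillable (Suc k) Y"
  shows "fillable k (loop_space Y y)"
  unfolding fillable_def
proof (intro allI impI, elim conjE)
  let ?L = "loop_space Y y" and ?I = "top_of_set {0..1::real}" and ?m = "Suc k"
  let ?C = "cube ?m" and ?bd = "cube_boundary ?m"
  fix f U assume U: "openin ?L U" "f \<in> U"
  have f: "f \<in> topspace ?L" using U openin_subset by blast
  then have f01: "f 0 = y" "f 1 = y" and yY: "y \<in> topspace Y"
    using continuous_map_funspace[of ?I Y f] by (auto simp: topspace_loop_space Pi_iff)
  from U obtain \<L> where \<L>: "finite \<L>"
    "\<And>K W. (K, W) \<in> \<L> \<Longrightarrow> K \<subseteq> {0..1} \<and> compact K \<and> openin Y W \<and> f ` K \<subseteq> W"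
    and \<L>U: "\<And>g. g \<in> topspace ?L \<Longrightarrow> (\<And>K W. (K, W) \<in> \<L> \<Longrightarrow> g ` K \<subseteq> W) \<Longrightarrow> g \<in> U"
    by (rule loop_space_neighbourhood) blast
  \<comment> \<open>\<open>Bolzano\<close> ranges over all intervals, so the guard makes degenerate
    ones and those leaving \<open>{0..1}\<close> hold trivially.\<close>
  define P where "P = (\<lambda>a b. 0 \<le> a \<and> a < b \<and> b \<le> 1 \<longrightarrow> slab_fillable ?m Y y f \<L> a b)"
  have "P 0 1"
  proof (rule Bolzano)
    fix a b c assume "P a b" "P b c" "a \<le> b" "b \<le> c"
    then show "P a c"
      using slab_fillable_trans[OF k(1) f, of \<L> a b c] unfolding P_def
      by (cases "a = b"; cases "b = c") auto
  next
    fix x :: real assume "0 \<le> x" "x \<le> 1"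
    then have "x \<in> {0..1}" by simp
    from slab_fillable_local[OF k(2) f this \<L>] obtain d where "d > 0"
      "\<And>a b. \<lbrakk>0 \<le> a; a \<le> x; x \<le> b; b \<le> 1; a < b; b - a < d\<rbrakk> \<Longrightarrow> slab_fillable ?m Y y f \<L> a b"
      by metis
    then show "\<exists>d>0. \<forall>a b. a \<le> x \<and> x \<le> b \<and> b - a < d \<longrightarrow> P a b"
      unfolding P_def by blast
  qed simp
  then have "slab_fillable ?m Y y f \<L> 0 1" by (simp add: P_def)
  then obtain A B V where 1: "f 0 \<in> A" "f 1 \<in> B" "openin ?L V" "f \<in> V"
    and fill: "\<And>h \<phi> \<psi>. slab_data ?m Y A B V 0 1 h \<phi> \<psi> \<Longrightarrow> \<exists>H. slab_filling ?m Y \<L> 0 1 h \<phi> \<psi> H"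
    unfolding slab_fillable_def by blast
  have "\<exists>F. continuous_map ?C (subtopology ?L U) F \<and> (\<forall>t \<in> ?bd. F t = h t)"
    if h: "continuous_map (subtopology ?C ?bd) (subtopology ?L V) h" for h
  proof -
    have hL: "continuous_map (subtopology ?C ?bd) ?L h"
      using h by (simp add: continuous_map_in_subtopology)
    have hV: "h t \<in> V" if "t \<in> ?bd" for t
      using continuous_map_funspace[OF h] that cube_boundary_subset by fastforce
    have hy: "h t \<in> extensional {0..1} \<and> h t 0 = y \<and> h t 1 = y" if "t \<in> ?bd" for t
      using hV[OF that] openin_subset[OF 1(3)] by (auto simp: topspace_loop_space)
    have "continuous_map (prod_topology (subtopology ?C ?bd) ?I) ?L (\<lambda>p. h (fst p))"
      using continuous_map_compose[OF continuous_map_fst hL] by (simp add: o_def)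
    \<comment> \<open>Every loop is at \<open>y\<close> at times 0 and 1, so constant end faces
      match the side wall; they also make every \<open>F t\<close> below a loop at
      \<open>y\<close>.\<close>
    from continuous_map_loop_eval[OF this continuous_map_snd]
    have "slab_data ?m Y A B V 0 1 h (\<lambda>_. y) (\<lambda>_. y)"
      unfolding slab_data_def using hV hy 1(1,2) f01 yY
      by (auto simp: continuous_map_in_subtopology)
    from fill[OF this] obtain H where
      H: "continuous_map (prod_topology ?C euclideanreal) Y (\<lambda>p. H (fst p) (snd p))"
        "\<forall>t \<in> ?bd. \<forall>s \<in> {0..1}. H t s = h t s"
        "\<forall>t \<in> topspace ?C. H t 0 = y \<and> H t 1 = y"
        "\<forall>t \<in> topspace ?C. \<forall>s \<in> {0..1}. \<forall>p \<in> \<L>. s \<in> fst p \<longrightarrow> H t s \<in> snd p"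
      unfolding slab_filling_def by (elim exE conjE)
    define F where "F = (\<lambda>t. restrict (H t) {0..1})"
    have cF: "continuous_map ?C ?L F"
    proof (rule continuous_map_into_loop_space)
      have "continuous_map (prod_topology ?C ?I) Y (\<lambda>p. H (fst p) (snd p))"
        using continuous_map_from_subtopology[OF H(1), of "topspace ?C \<times> {0..1}"]
        by (simp add: prod_topology_subtopology)
      then show "continuous_map (prod_topology ?C ?I) Y (\<lambda>(t, s). F t s)"
        by (rule continuous_map_eq) (auto simp: F_def)
    qed (use H(3) in \<open>simp add: F_def\<close>)
    have "F t \<in> U" if t: "t \<in> topspace ?C" for t
    proof (rule \<L>U)
      show FL: "F t \<in> topspace ?L" using continuous_map_funspace[OF cF] t by auto
      fix K W assume KW: "(K, W) \<in> \<L>"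
      show "F t ` K \<subseteq> W"
      proof safe
        fix s assume s: "s \<in> K"
        show "F t s \<in> W"
          using H(4)[rule_format, OF t _ KW] \<L>(2)[OF KW] s by (auto simp: F_def)
      qed
    qed
    then have "continuous_map ?C (subtopology ?L U) F"
      using cF by (auto simp: continuous_map_in_subtopology)
    moreover have "F t = h t" if "t \<in> ?bd" for t
      using H(2) hy[OF that] that by (auto simp: F_def restrict_def extensional_def fun_eq_iff)
    ultimately show ?thesis by blast
  qed
  then show "\<exists>V. openin ?L V \<and> f \<in> V \<and> (\<forall>h. continuous_map (subtopology ?C ?bd) (subtopology ?L V) h \<longrightarrow>
          (\<exists>F. continuous_map ?C (subtopology ?L U) F \<and> (\<forall>t \<in> ?bd. F t = h t)))"
    using 1(3,4) by blast
qed

section \<open>Local connectedness in terms of cubes\<close>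

text \<open>Index \<open>k\<close> is included because \<open>nsphere k\<close> has
  \<open>k + 1\<close> coordinates. The balls of this norm are cubes, so dividing by it carries the
  round sphere to the boundary of a cube.\<close>

definition maxnorm :: "nat \<Rightarrow> (nat \<Rightarrow> real) \<Rightarrow> real"
  where "maxnorm k u = Max ((\<lambda>i. \<bar>u i\<bar>) ` {..k})"

lemma maxnorm_ge: "i \<le> k \<Longrightarrow> \<bar>u i\<bar> \<le> maxnorm k u"
  by (simp add: maxnorm_def)

lemma maxnorm_attained: obtains i where "i \<le> k" "maxnorm k u = \<bar>u i\<bar>"
proof -
  have "maxnorm k u \<in> (\<lambda>i. \<bar>u i\<bar>) ` {..k}"
    unfolding maxnorm_def by (rule Max_in) auto
  then show ?thesis using that by auto
qed

lemma maxnorm_nonneg: "0 \<le> maxnorm k u"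
  using maxnorm_ge[of 0 k u] by simp

lemma maxnorm_eqI:
  assumes "\<And>i. i \<le> k \<Longrightarrow> \<bar>u i\<bar> \<le> c" "i \<le> k" "\<bar>u i\<bar> = c"
  shows "maxnorm k u = c"
  using assms maxnorm_ge[of i k u] by (metis maxnorm_attained order_antisym)

lemma maxnorm_scale:
  assumes "\<And>i. i \<le> k \<Longrightarrow> v i = c * u i"
  shows "maxnorm k v = \<bar>c\<bar> * maxnorm k u"
proof -
  obtain i where i: "i \<le> k" "maxnorm k u = \<bar>u i\<bar>" by (rule maxnorm_attained)
  show ?thesis
  proof (rule maxnorm_eqI[of _ _ _ i])
    show "\<bar>v j\<bar> \<le> \<bar>c\<bar> * maxnorm k u" if "j \<le> k" for j
      using that maxnorm_ge[of j k u] by (simp add: assms abs_mult mult_left_mono)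
  qed (use i assms in \<open>simp_all add: abs_mult\<close>)
qed

lemma continuous_map_maxnorm:
  assumes "\<And>i. i \<le> k \<Longrightarrow> continuous_map Z euclideanreal (\<lambda>z. g z i)"
  shows "continuous_map Z euclideanreal (\<lambda>z. maxnorm k (g z))"
  using assms
proof (induction k)
  case 0
  then show ?case by (simp add: maxnorm_def continuous_map_real_abs)
next
  case (Suc k)
  have "maxnorm (Suc k) u = max \<bar>u (Suc k)\<bar> (maxnorm k u)" for u
    unfolding maxnorm_def atMost_Suc by (subst image_insert, subst Max_insert) auto
  then show ?case
    using Suc by (simp add: continuous_map_real_max continuous_map_real_abs)
qed

section \<open>The cube as a quotient of the cylinder over the sphere\<close>

lemma topspace_nsphere:
  "topspace (nsphere k) = {u. (\<forall>i>k. u i = 0) \<and> (\<Sum>i\<le>k. (u i)\<^sup>2) = 1}"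
  by (auto simp: nsphere_def topspace_Euclidean_space Suc_le_eq)

text \<open>A closed subset of a product of copies of \<open>{-1..1}\<close>. Compactness will make
  \<open>radial\<close> a quotient map.\<close>

lemma compact_space_nsphere: "compact_space (nsphere k)"
proof -
  let ?S = "{u :: nat \<Rightarrow> real. (\<Sum>i\<le>k. (u i)\<^sup>2) = 1 \<and> (\<forall>i>k. u i = 0)}"
  have "closed {u :: nat \<Rightarrow> real. (\<Sum>i\<le>k. (u i)\<^sup>2) = 1}"
    by (intro closed_Collect_eq continuous_intros continuous_on_product_coordinates)
  moreover have "closed {u :: nat \<Rightarrow> real. \<forall>i>k. u i = 0}"
  proof -
    have "closed {u :: nat \<Rightarrow> real. k < i \<longrightarrow> u i = 0}" for i
      by (cases "k < i") (simp_all add: closed_Collect_eq continuous_on_product_coordinates)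
    then show ?thesis by (intro closed_Collect_all)
  qed
  ultimately have "closed ?S" by (simp add: Collect_conj_eq closed_Int)
  moreover have "?S \<subseteq> Pi\<^sub>E UNIV (\<lambda>i. {-1..1})"
  proof
    fix u assume u: "u \<in> ?S"
    have "\<bar>u i\<bar> \<le> 1" for i
    proof (cases "i \<le> k")
      case True
      have "(u i)\<^sup>2 \<le> (\<Sum>i\<le>k. (u i)\<^sup>2)"
        by (rule member_le_sum) (use True in auto)
      then show ?thesis using u by (simp add: abs_square_le_1)
    qed (use u in auto)
    then show "u \<in> Pi\<^sub>E UNIV (\<lambda>i. {-1..1})" by (auto simp: PiE_iff abs_le_iff minus_le_iff)
  qed
  moreover have "compactin (powertop_real UNIV) (Pi\<^sub>E UNIV (\<lambda>i. {-1..1}))"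
    by (simp add: compactin_PiE)
  ultimately have "compactin (powertop_real UNIV) ?S"
    using closed_compactin[of "powertop_real UNIV"] by (simp add: euclidean_product_topology)
  then show ?thesis
    by (simp add: nsphere compact_space_subtopology)
qed

text \<open>Collapses the end \<open>fst p = 1\<close> of the cylinder over the sphere to the centre of the cube and maps
  the end \<open>fst p = 0\<close> onto its boundary.\<close>

definition radial :: "nat \<Rightarrow> real \<times> (nat \<Rightarrow> real) \<Rightarrow> nat \<Rightarrow> real"
  where "radial k p = (\<lambda>i. if i \<le> k
    then 1/2 + (1 - fst p) * (snd p i / (2 * maxnorm k (snd p))) else 0)"

lemma maxnorm_nsphere_pos:
  assumes "u \<in> topspace (nsphere k)"
  shows "0 < maxnorm k u"
proof (rule ccontr)
  assume "\<not> ?thesis"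
  then have "u i = 0" if "i \<le> k" for i
    using maxnorm_ge[OF that, of u] by simp
  then show False using assms by (simp add: topspace_nsphere)
qed

lemma radial_in_cube:
  assumes "r \<in> {0..1}" "u \<in> topspace (nsphere k)"
  shows "radial k (r, u) \<in> topspace (cube (Suc k))"
proof -
  have "radial k (r, u) i \<in> {0..1}" if "i \<le> k" for i
  proof -
    have "\<bar>u i / (2 * maxnorm k u)\<bar> \<le> 1/2"
      using maxnorm_ge[OF that, of u] maxnorm_nsphere_pos[OF assms(2)] by (simp add: divide_simps)
    then have "(1 - r) * \<bar>u i / (2 * maxnorm k u)\<bar> \<le> 1 * (1/2)"
      using assms by (intro mult_mono) auto
    then have "\<bar>(1 - r) * (u i / (2 * maxnorm k u))\<bar> \<le> 1/2"
      using assms unfolding abs_mult by simp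
    moreover have "radial k (r, u) i = 1/2 + (1 - r) * (u i / (2 * maxnorm k u))"
      using that by (simp add: radial_def)
    ultimately show ?thesis unfolding abs_le_iff atLeastAtMost_iff by linarith
  qed
  then show ?thesis by (simp add: topspace_cube less_Suc_eq_le) (simp add: radial_def)
qed

lemma continuous_map_radial:
  "continuous_map (prod_topology (top_of_set {0..1}) (nsphere k)) (cube (Suc k)) (radial k)"
  unfolding continuous_map_into_cube
proof (intro conjI allI impI)
  let ?P = "prod_topology (top_of_set {0..1::real}) (nsphere k)"
  have fst: "continuous_map ?P euclideanreal (\<lambda>p. fst p)"
    using continuous_map_fst[of "top_of_set {0..1::real}" "nsphere k"]
    by (simp add: continuous_map_in_subtopology)
  have snd: "continuous_map ?P euclideanreal (\<lambda>p. snd p i)" for i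
    using continuous_map_compose[OF continuous_map_snd continuous_map_nsphere_projection] by (simp add: o_def)
  show "continuous_map ?P euclideanreal (\<lambda>p. radial k p i)" if "i < Suc k" for i
  proof -
    have "continuous_map ?P euclideanreal
        (\<lambda>p. 1/2 + (1 - fst p) * (snd p i / (2 * maxnorm k (snd p))))"
      by (intro continuous_map_add continuous_map_real_mult continuous_map_real_divide continuous_map_diff
          continuous_map_canonical_const continuous_map_maxnorm fst snd)
         (use maxnorm_nsphere_pos in force)
    then show ?thesis using that by (simp add: radial_def)
  qed
  show "radial k \<in> topspace ?P \<rightarrow> topspace (cube (Suc k))"
    using radial_in_cube by auto
qed

text \<open>Polar coordinates about the centre of the cube. The direction is normalised in the
  Euclidean norm, to lie on the round sphere, but the radius is measured in the max norm, which
  equals 1/2 on the boundary; hence \<open>r\<close> is 1 minus twice that norm.\<close>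

lemma radial_surj:
  assumes "t \<in> topspace (cube (Suc k))"
  obtains r u where "r \<in> {0..1}" "u \<in> topspace (nsphere k)" "radial k (r, u) = t"
    "t \<in> cube_boundary (Suc k) \<Longrightarrow> r = 0"
proof -
  define v where "v = (\<lambda>i. if i \<le> k then t i - 1/2 else 0)"
  have t01: "0 \<le> t i" "t i \<le> 1" if "i \<le> k" for i
    using assms that by (auto simp: topspace_cube)
  have t0: "t i = 0" if "\<not> i \<le> k" for i
    using assms that by (auto simp: topspace_cube)
  have v: "\<bar>v i\<bar> \<le> 1/2" if "i \<le> k" for i
    using t01[OF that] that unfolding abs_le_iff by (simp add: v_def)
  have R: "maxnorm k v \<le> 1/2"
    using v by (metis maxnorm_attained)
  have Rb: "maxnorm k v = 1/2" if "t \<in> cube_boundary (Suc k)"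
  proof -
    from that obtain i where "i < Suc k" "t i = 0 \<or> t i = 1" by (auto simp: cube_boundary_def)
    then have "i \<le> k" "\<bar>v i\<bar> = 1/2" by (auto simp: v_def)
    then show ?thesis using maxnorm_eqI v by blast
  qed
  define n where "n = sqrt (\<Sum>i\<le>k. (v i)\<^sup>2)"
  show ?thesis
  proof (cases "n = 0")
    case True
    have "(\<Sum>i\<le>k. (v i)\<^sup>2) = 0" using True by (simp add: n_def)
    then have v0: "v i = 0" if "i \<le> k" for i
      using that by (simp add: sum_nonneg_eq_0_iff)
    have "maxnorm k v = 0" by (rule maxnorm_eqI[of _ _ _ 0]) (simp_all add: v0)
    then have nb: "t \<notin> cube_boundary (Suc k)" using Rb by auto
    show ?thesis
    \<comment> \<open>The centre has no direction of its own; the first unit vector serves.\<close>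
    proof (rule that[of 1 "\<lambda>n. if n = 0 then 1 else 0"])
      show "radial k (1, \<lambda>n. if n = 0 then 1 else 0) = t"
        using v0 t0 by (auto simp: radial_def v_def fun_eq_iff)
    qed (use in_topspace_nsphere nb in auto)
  next
    case False
    have "0 \<le> n" by (simp add: n_def sum_nonneg)
    with False have n: "0 < n" by simp
    have n2: "n\<^sup>2 = (\<Sum>i\<le>k. (v i)\<^sup>2)" by (simp add: n_def sum_nonneg)
    define u where "u = (\<lambda>i. v i / n)"
    have "(\<Sum>i\<le>k. (u i)\<^sup>2) = (\<Sum>i\<le>k. (v i)\<^sup>2) / n\<^sup>2"
      by (simp add: u_def power_divide sum_divide_distrib)
    also have "\<dots> = 1" using n by (simp flip: n2)
    finally have "(\<Sum>i\<le>k. (u i)\<^sup>2) = 1" .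
    moreover have "u i = 0" if "i > k" for i using that by (simp add: u_def v_def)
    ultimately have u: "u \<in> topspace (nsphere k)"
      by (simp add: topspace_nsphere)
    have Nu: "maxnorm k u = maxnorm k v / n"
      using maxnorm_scale[of k u "1/n" v] n by (simp add: u_def)
    have Rpos: "0 < maxnorm k v" using maxnorm_nsphere_pos[OF u] n by (simp add: Nu zero_less_divide_iff)
    show ?thesis
    proof (rule that[of "1 - 2 * maxnorm k v" u])
      show "radial k (1 - 2 * maxnorm k v, u) = t"
      proof
        fix i show "radial k (1 - 2 * maxnorm k v, u) i = t i"
          using n Rpos t0[of i] by (simp add: radial_def Nu) (simp add: u_def v_def)
      qed
    qed (use R Rb u maxnorm_nonneg in auto)
  qed
qed

text \<open>The fibres are single points apart from the collapsed end. The vectors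
  \<open>a u\<close> and \<open>a u'\<close> have max norm 1/2, so comparing norms gives
  \<open>r = r'\<close>. Away from the collapsed end, \<open>u\<close> is then a positive multiple
  of \<open>u'\<close>, and both have Euclidean norm 1.\<close>

lemma radial_eqD:
  assumes u: "u \<in> topspace (nsphere k)" "u' \<in> topspace (nsphere k)"
    and r: "r \<in> {0..1}" "r' \<in> {0..1}" and eq: "radial k (r, u) = radial k (r', u')"
  shows "r = r'" "r = 1 \<or> u = u'"
proof -
  define a where "a = (\<lambda>u i. u i / (2 * maxnorm k u))"
  have Na: "maxnorm k (\<lambda>i. r * a u i) = r / 2" if "u \<in> topspace (nsphere k)" "0 \<le> r" for u r
    using maxnorm_scale[of k "\<lambda>i. r * a u i" "r / (2 * maxnorm k u)" u] maxnorm_nsphere_pos[OF that(1)] that(2)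
    by (simp add: a_def)
  have e: "(1 - r) * a u i = (1 - r') * a u' i" if "i \<le> k" for i
    using fun_cong[OF eq, of i] that by (simp add: radial_def a_def)
  have "maxnorm k (\<lambda>i. (1 - r) * a u i) = maxnorm k (\<lambda>i. (1 - r') * a u' i)"
    using maxnorm_scale[of k "\<lambda>i. (1 - r) * a u i" 1 "\<lambda>i. (1 - r') * a u' i"] e by simp
  then show rr: "r = r'" using Na[OF u(1), of "1 - r"] Na[OF u(2), of "1 - r'"] r by simp
  show "r = 1 \<or> u = u'"
  proof (cases "r = 1")
    case False
    note pos = maxnorm_nsphere_pos[OF u(1)] maxnorm_nsphere_pos[OF u(2)]
    define c where "c = maxnorm k u / maxnorm k u'"
    have c: "u i = c * u' i" if "i \<le> k" for i
    proof -
      have "a u i = a u' i" using e[OF that] False rr by simp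
      then show ?thesis using pos by (simp add: a_def c_def field_simps)
    qed
    have "1 = (\<Sum>i\<le>k. (u i)\<^sup>2)" using u(1) by (simp add: topspace_nsphere)
    also have "\<dots> = (\<Sum>i\<le>k. c\<^sup>2 * (u' i)\<^sup>2)" by (rule sum.cong) (simp_all add: c power_mult_distrib)
    also have "\<dots> = c\<^sup>2" using u(2) by (simp add: topspace_nsphere flip: sum_distrib_left)
    finally have "c = 1 \<or> c = -1" by (metis power2_eq_1_iff)
    moreover have "0 < c" using pos by (simp add: c_def)
    ultimately have "c = 1" by simp
    then have "u i = u' i" for i
      using c[of i] u by (cases "i \<le> k") (simp_all add: topspace_nsphere)
    then show ?thesis by auto
  qed simp
qed

text \<open>A null homotopy is constant on the end that \<open>radial\<close> collapses, hence
  constant on the fibres of \<open>radial\<close>. It descends to the cube because a continuous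
  surjection from a compact space to a Hausdorff space is a quotient map.\<close>

lemma nullhomotopic_extends_to_cube:
  assumes "nullhomotopic_map (nsphere k) Z (\<lambda>u. f (radial k (0, u)))"
  shows "\<exists>F. continuous_map (cube (Suc k)) Z F \<and> (\<forall>t \<in> cube_boundary (Suc k). F t = f t)"
proof -
  let ?P = "prod_topology (top_of_set {0..1::real}) (nsphere k)"
  obtain c h where h: "continuous_map ?P Z h"
    and h0: "\<And>u. h (0, u) = f (radial k (0, u))" and h1: "\<And>u. h (1, u) = c"
    using assms unfolding nullhomotopic_map_def homotopic_with_def by blast
  have "radial k ` topspace ?P = topspace (cube (Suc k))"
  proof (intro equalityI subsetI)
    fix t assume "t \<in> topspace (cube (Suc k))"
    then obtain r u where "r \<in> {0..1}" "u \<in> topspace (nsphere k)" "radial k (r, u) = t"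
      by (rule radial_surj) blast
    then show "t \<in> radial k ` topspace ?P" by (intro image_eqI[of _ _ "(r, u)"]) auto
  qed (use radial_in_cube in auto)
  then have "quotient_map ?P (cube (Suc k)) (radial k)"
    by (intro continuous_imp_quotient_map continuous_map_radial Hausdorff_space_cube)
       (simp add: compact_space_prod_topology compact_space_nsphere compact_space_subtopology)
  moreover have "h p = h p'" if "p \<in> topspace ?P" "p' \<in> topspace ?P" "radial k p = radial k p'" for p p'
    using radial_eqD[of "snd p" k "snd p'" "fst p" "fst p'"] that h1 by (cases p; cases p') auto
  ultimately obtain F where F: "continuous_map (cube (Suc k)) Z F"
    and Fh: "\<And>p. p \<in> topspace ?P \<Longrightarrow> F (radial k p) = h p"
    using quotient_map_lift_exists[OF _ h] by metis
  have "F t = f t" if t: "t \<in> cube_boundary (Suc k)" for t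
  proof -
    have "t \<in> topspace (cube (Suc k))" using t cube_boundary_subset by blast
    then obtain r u where "u \<in> topspace (nsphere k)" "radial k (r, u) = t" "r = 0"
      using t by (metis radial_surj)
    then show ?thesis using Fh[of "(0, u)"] h0[of u] by simp
  qed
  with F show ?thesis by blast
qed

lemma locally_n_connected_imp_fillable:
  assumes X: "locally_n_connected n X" and "k \<le> n"
  shows "fillable k X"
  unfolding fillable_def
proof (intro allI impI, elim conjE)
  let ?bd = "subtopology (cube (Suc k)) (cube_boundary (Suc k))"
  fix y U assume U: "openin X U" "y \<in> U"
  then have "nbhd_of X y U" "y \<in> topspace X"
    using openin_subset[OF U(1)] by (auto simp: nbhd_of_def interior_of_openin)
  then obtain V where V: "nbhd_of X y V"
    and null: "\<And>f. continuous_map (nsphere k) (subtopology X V) f \<Longrightarrow>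
             nullhomotopic_map (nsphere k) (subtopology X U) f"
    using X \<open>k \<le> n\<close> unfolding locally_n_connected_def by metis
  \<comment> \<open>A neighbourhood in the sense of \<open>nbhd_of\<close> may fail to be open, so
    its interior is the set offered to \<open>fillable\<close>.\<close>
  have "\<exists>F. continuous_map (cube (Suc k)) (subtopology X U) F \<and> (\<forall>t \<in> cube_boundary (Suc k). F t = f t)"
    if f: "continuous_map ?bd (subtopology X (X interior_of V)) f" for f
  proof (rule nullhomotopic_extends_to_cube, rule null)
    have "continuous_map (nsphere k) (prod_topology (top_of_set {0..1::real}) (nsphere k)) (\<lambda>u. (0, u))"
      by (intro continuous_map_pairedI) (auto intro: continuous_map_id[unfolded id_def])
    from continuous_map_compose[OF this continuous_map_radial]
    have "continuous_map (nsphere k) (cube (Suc k)) (\<lambda>u. radial k (0, u))" by (simp add: o_def)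
    moreover have "radial k (0, u) \<in> cube_boundary (Suc k)" if u: "u \<in> topspace (nsphere k)" for u
    proof -
      \<comment> \<open>A coordinate attaining the max norm is sent to \<open>1/2 + 1/2\<close> or
        \<open>1/2 - 1/2\<close>, so the image lies on a face.\<close>
      obtain i where i: "i \<le> k" "maxnorm k u = \<bar>u i\<bar>" by (rule maxnorm_attained)
      then have "radial k (0, u) i = 0 \<or> radial k (0, u) i = 1"
        using maxnorm_nsphere_pos[OF u] by (auto simp: radial_def abs_if)
      then show ?thesis
        using i(1) radial_in_cube[OF _ u, of 0] less_Suc_eq_le by (auto simp: cube_boundary_def)
    qed
    ultimately have "continuous_map (nsphere k) ?bd (\<lambda>u. radial k (0, u))"
      by (auto simp: continuous_map_in_subtopology)
    from continuous_map_compose[OF this f]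
    show "continuous_map (nsphere k) (subtopology X V) (\<lambda>u. f (radial k (0, u)))"
      using interior_of_subset[of X V] by (auto simp: o_def continuous_map_in_subtopology)
  qed
  then show "\<exists>V. openin X V \<and> y \<in> V \<and> (\<forall>f. continuous_map ?bd (subtopology X V) f \<longrightarrow>
          (\<exists>F. continuous_map (cube (Suc k)) (subtopology X U) F \<and>
            (\<forall>t \<in> cube_boundary (Suc k). F t = f t)))"
    using V by (intro exI[of _ "X interior_of V"]) (auto simp: nbhd_of_def)
qed

section \<open>Discreteness\<close>

text \<open>\<open>cube 0\<close> is a single point with empty boundary, so a 0-loop is an arbitrary
  point of \<open>X\<close>. This starts the induction on the number of loop coordinates.\<close>

lemma nloop_space_0_homeomorphic: "X homeomorphic_space nloop_space 0 X x"
proof -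
  let ?N = "nloop_space 0 X x" and ?o = "(\<lambda>_. 0) :: nat \<Rightarrow> real"
  have cube0: "topspace (cube 0) = {?o}" by (auto simp: topspace_cube)
  have "continuous_map X ?N (\<lambda>c. \<lambda>t\<in>topspace (cube 0). c)"
  proof (rule continuous_map_into_nloop_space)
    show "continuous_map (prod_topology X (cube 0)) X (\<lambda>(c, t). (\<lambda>t\<in>topspace (cube 0). c) t)"
      by (rule continuous_map_eq[OF continuous_map_fst]) auto
  qed (auto simp: cube_boundary_def)
  moreover have "continuous_map ?N X (\<lambda>g. g ?o)"
    by (rule continuous_map_nloop_eval[OF continuous_map_id[unfolded id_def]]) (simp add: cube0)
  moreover have "(\<lambda>t\<in>topspace (cube 0). g ?o) = g" if "g \<in> topspace ?N" for g
    using that by (auto simp: topspace_nloop_space nloops_def cube0 extensional_def)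
  ultimately have "homeomorphic_maps X ?N (\<lambda>c. \<lambda>t\<in>topspace (cube 0). c) (\<lambda>g. g ?o)"
    by (simp add: homeomorphic_maps_def cube0)
  then show ?thesis unfolding homeomorphic_space_def by blast
qed

text \<open>The induction must range over all \<open>k\<close>: dimension \<open>k\<close> at level
  \<open>Suc j\<close> draws on dimensions \<open>k\<close> and \<open>Suc k\<close> at level
  \<open>j\<close>, and for both the sum stays at most \<open>n\<close>.\<close>

lemma fillable_nloop_space:
  assumes "locally_n_connected n X" "k + j \<le> n"
  shows "fillable k (nloop_space j X x)"
  using assms(2)
proof (induction j arbitrary: k)
  case 0
  then have "fillable k X" using locally_n_connected_imp_fillable[OF assms(1)] by simp
  then show ?case by (rule homeomorphic_fillable[OF _ nloop_space_0_homeomorphic])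
next
  case (Suc j)
  then have "fillable k (nloop_space j X x)" "fillable (Suc k) (nloop_space j X x)" by simp_all
  then have "fillable k (loop_space (nloop_space j X x) (\<lambda>t \<in> topspace (cube j). x))"
    by (rule fillable_loop_space)
  then show ?case
    by (rule homeomorphic_fillable) (subst homeomorphic_space_sym, rule nloop_space_Suc_homeomorphic)
qed

section \<open>Homotopies of n-loops and open homotopy classes\<close>

text \<open>Only extensionality of \<open>f\<close> and \<open>g\<close> is demanded; their
  continuity and boundary values are read off from the ends of the homotopy. Later closure results
  exploit this and obtain membership in \<open>nloops\<close> from a homotopy.\<close>

lemma nloop_homotopyI:
  assumes "f \<in> extensional (topspace (cube n))" "g \<in> extensional (topspace (cube n))"
    and h: "continuous_map (prod_topology (top_of_set {0..1::real}) (cube n)) X h"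
    and "\<And>t. t \<in> topspace (cube n) \<Longrightarrow> h (0, t) = f t"
    and "\<And>t. t \<in> topspace (cube n) \<Longrightarrow> h (1, t) = g t"
    and "\<And>s t. s \<in> {0..1} \<Longrightarrow> t \<in> cube_boundary n \<Longrightarrow> h (s, t) = x"
  shows "(f, g) \<in> nloop_homotopy n X x"
proof -
  let ?P = "\<lambda>h. \<forall>t \<in> cube_boundary n. h t = x"
  have "homotopic_with ?P (cube n) X f g"
  \<comment> \<open>The definition of \<open>homotopic_with\<close> fixes the ends at all arguments.
    As the boundary condition depends only on values on the cube, agreement there suffices.\<close>
  proof (subst homotopic_with)
    show "?P h \<longleftrightarrow> ?P k" if "\<And>t. t \<in> topspace (cube n) \<Longrightarrow> h t = k t" for h k :: "(nat \<Rightarrow> real) \<Rightarrow> 'a"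
      using that cube_boundary_subset by (metis subsetD)
    show "\<exists>h. continuous_map (prod_topology (top_of_set {0..1::real}) (cube n)) X h \<and>
        (\<forall>t \<in> topspace (cube n). h (0, t) = f t) \<and> (\<forall>t \<in> topspace (cube n). h (1, t) = g t) \<and>
        (\<forall>s \<in> {0..1}. ?P (\<lambda>t. h (s, t)))"
      using assms(4-6) by (intro exI[of _ h] conjI h) auto
  qed
  from this homotopic_with_imp_continuous_maps[OF this] homotopic_with_imp_property[OF this]
  show ?thesis using assms(1,2) by (simp add: nloop_homotopy_def nloops_def)
qed

lemma nloop_homotopyE:
  assumes "(f, g) \<in> nloop_homotopy n X x"
  obtains h where "continuous_map (prod_topology (top_of_set {0..1::real}) (cube n)) X h"
    "\<And>t. h (0, t) = f t" "\<And>t. h (1, t) = g t"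
    "\<And>s t. s \<in> {0..1} \<Longrightarrow> t \<in> cube_boundary n \<Longrightarrow> h (s, t) = x"
proof -
  obtain h where "continuous_map (prod_topology (top_of_set {0..1::real}) (cube n)) X h"
    "\<forall>t. h (0, t) = f t" "\<forall>t. h (1, t) = g t" "\<forall>s\<in>{0..1}. \<forall>t \<in> cube_boundary n. h (s, t) = x"
    using assms unfolding nloop_homotopy_def homotopic_with_def by auto
  then show ?thesis by (intro that[of h]) auto
qed

lemma equiv_nloop_homotopy: "equiv (nloops n X x) (nloop_homotopy n X x)"
proof (rule equivI)
  show "nloop_homotopy n X x \<subseteq> nloops n X x \<times> nloops n X x"
    by (auto simp: nloop_homotopy_def)
  show "refl_on (nloops n X x) (nloop_homotopy n X x)"
    by (auto simp: refl_on_def nloop_homotopy_def nloops_def)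
  show "sym (nloop_homotopy n X x)"
    by (auto simp: sym_def nloop_homotopy_def homotopic_with_sym)
  show "trans (nloop_homotopy n X x)"
    by (auto simp: trans_def nloop_homotopy_def intro: homotopic_with_trans)
qed

lemma nloop_homotopic_nearby:
  assumes X: "fillable 0 (nloop_space n X x)" and f: "f \<in> nloops n X x"
  obtains V where "openin (nloop_space n X x) V" "f \<in> V" "\<And>g. g \<in> V \<Longrightarrow> (f, g) \<in> nloop_homotopy n X x"
proof -
  let ?N = "nloop_space n X x" and ?S = "subtopology (cube (Suc 0)) (cube_boundary (Suc 0))"
  let ?I = "top_of_set {0..1::real}"
  have "f \<in> topspace ?N" using f by (simp add: topspace_nloop_space)
  \<comment> \<open>Any path in the loop space will do, so the set in which to fill is the entire
    space.\<close>
  from fillableE[OF X openin_topspace this] obtain V where V: "openin ?N V" "f \<in> V"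
    and fill: "\<And>h. continuous_map ?S (subtopology ?N V) h \<Longrightarrow>
      \<exists>F. continuous_map (cube (Suc 0)) (subtopology ?N (topspace ?N)) F \<and> (\<forall>t \<in> cube_boundary (Suc 0). F t = h t)"
    by metis
  have "(f, g) \<in> nloop_homotopy n X x" if g: "g \<in> V" for g
  proof -
    have fg: "f \<in> nloops n X x" "g \<in> nloops n X x"
      using V g openin_subset[OF V(1)] by (auto simp: topspace_nloop_space)
    have idS: "continuous_map ?S (cube (Suc 0)) (\<lambda>t. t)"
      using continuous_map_from_subtopology[OF continuous_map_id[unfolded id_def]] .
    \<comment> \<open>The boundary of \<open>cube (Suc 0)\<close> consists of two points. The
      threshold 1/2 merely separates them, and agreement at it is vacuous.\<close>
    have "continuous_map ?S (subtopology ?N V) (\<lambda>t. if t 0 \<le> 1/2 then f else g)"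
    proof (rule continuous_map_cases_le[OF continuous_map_cube_coord[OF idS]])
      fix t assume "t \<in> topspace ?S" "t 0 = (1/2 :: real)"
      then show "f = g" by (auto simp: cube_boundary_def)
    qed (use fg V g in \<open>auto simp: topspace_nloop_space\<close>)
    from fill[OF this] obtain F where F: "continuous_map (cube (Suc 0)) ?N F"
      and Fb: "\<And>t. t \<in> cube_boundary (Suc 0) \<Longrightarrow> F t = (if t 0 \<le> 1/2 then f else g)"
      by auto
    define p where "p = (\<lambda>s::real. (\<lambda>_::nat. 0::real)(0 := s))"
    have p: "p s \<in> topspace (cube (Suc 0))" if "s \<in> {0..1}" for s
      using that by (simp add: p_def topspace_cube)
    have Fp: "F (p 0) = f" "F (p 1) = g"
      using p[of 0] p[of 1] Fb[of "p 0"] Fb[of "p 1"] by (auto simp: cube_boundary_def p_def)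
    have FN: "F (p s) \<in> nloops n X x" if "s \<in> {0..1}" for s
      using continuous_map_funspace[OF F] p[OF that] by (auto simp: topspace_nloop_space)
    have "continuous_map (prod_topology ?I (cube n)) (cube (Suc 0)) (\<lambda>q. p (fst q))"
      unfolding p_def by (rule continuous_map_cube_join[OF _ continuous_map_fst]) (simp add: topspace_cube)
    from continuous_map_compose[OF this F]
    have "continuous_map (prod_topology ?I (cube n)) ?N (\<lambda>q. F (p (fst q)))" by (simp add: o_def)
    note c = continuous_map_nloop_eval[OF this continuous_map_snd]
    show ?thesis
      by (rule nloop_homotopyI[OF _ _ c]) (use fg Fp FN in \<open>auto simp: nloops_def\<close>)
  qed
  with V show ?thesis by (rule that)
qed

lemma topspace_homotopy_group_topology:
  "topspace (homotopy_group_topology n X x) = carrier (homotopy_group n X x)"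
proof -
  have "topspace (homotopy_group_topology n X x) = nloop_class n X x ` topspace (nloop_space n X x)"
    using quotient_map_quotient_topology[of "nloop_space n X x" "nloop_class n X x"]
    by (simp add: homotopy_group_topology_def quotient_map_def)
  then show ?thesis
    by (auto simp: homotopy_group_def quotient_def nloop_class_def topspace_nloop_space)
qed

lemma homotopy_group_topology_discrete:
  assumes "fillable 0 (nloop_space n X x)"
  shows "homotopy_group_topology n X x = discrete_topology (carrier (homotopy_group n X x))"
proof -
  let ?N = "nloop_space n X x" and ?q = "nloop_class n X x"
  have "openin (homotopy_group_topology n X x) {A}" if "A \<in> carrier (homotopy_group n X x)" for A
  proof -
    obtain f where f: "f \<in> nloops n X x" "A = ?q f"
      using \<open>A \<in> carrier (homotopy_group n X x)\<close> by (auto simp: homotopy_group_def quotient_def nloop_class_def)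
    have "openin ?N {g \<in> topspace ?N. ?q g \<in> {A}}"
    proof (subst openin_subopen, safe)
      fix g assume g: "g \<in> topspace ?N" and A: "A = ?q g"
      then have gN: "g \<in> nloops n X x" by (simp add: topspace_nloop_space)
      obtain V where V: "openin ?N V" "g \<in> V" "\<And>h. h \<in> V \<Longrightarrow> (g, h) \<in> nloop_homotopy n X x"
        using nloop_homotopic_nearby[OF assms gN] by blast
      have "?q h = ?q g" if "h \<in> V" for h
        unfolding nloop_class_def using equiv_class_eq[OF equiv_nloop_homotopy V(3)[OF that]] by simp
      then have "V \<subseteq> {h \<in> topspace ?N. ?q h \<in> {?q g}}"
        using openin_subset[OF V(1)] by auto
      with V show "\<exists>T. openin ?N T \<and> g \<in> T \<and> T \<subseteq> {h \<in> topspace ?N. ?q h \<in> {?q g}}" by blast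
    qed
    then show ?thesis
      using f by (simp add: homotopy_group_topology_def openin_quotient_topology topspace_nloop_space)
  qed
  then show ?thesis
    using topspace_homotopy_group_topology discrete_topology_unique by metis
qed

section \<open>The group structure\<close>

text \<open>Associativity, unit and inverses all compare two changes of the first coordinate of one
  loop, so a single homotopy lemma serves for the three.\<close>

definition reparam :: "nat \<Rightarrow> ((nat \<Rightarrow> real) \<Rightarrow> 'a) \<Rightarrow> (real \<Rightarrow> real) \<Rightarrow> (nat \<Rightarrow> real) \<Rightarrow> 'a"
  where "reparam n f \<phi> = (\<lambda>t \<in> topspace (cube n). f (t(0 := \<phi> (t 0))))"

lemma cube_upd_boundary_keep:
  assumes "t \<in> cube_boundary n" "s \<in> {0..1}" "0 < n" "t 0 = 0 \<or> t 0 = 1 \<Longrightarrow> s = 0 \<or> s = 1"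
  shows "t(0 := s) \<in> cube_boundary n"
proof -
  obtain i where i: "i < n" "t i = 0 \<or> t i = 1" and t: "t \<in> topspace (cube n)"
    using assms(1) by (auto simp: cube_boundary_def)
  show ?thesis
  proof (cases "i = 0")
    case True
    then show ?thesis using cube_upd_boundary[OF t assms(3)] assms(4) i by simp
  next
    case False
    then show ?thesis
      unfolding cube_boundary_def using cube_upd[OF t assms(3,2)] i
      by (intro CollectI conjI exI[of _ i]) auto
  qed
qed

lemma reparam_homotopic:
  assumes f: "f \<in> nloops n X x" and n: "0 < n"
    and \<phi>: "continuous_on {0..1} \<phi>" "\<phi> \<in> {0..1} \<rightarrow> {0..1}"
    and \<psi>: "continuous_on {0..1} \<psi>" "\<psi> \<in> {0..1} \<rightarrow> {0..1}"
    and ends: "\<phi> 0 = \<psi> 0" "\<phi> 1 = \<psi> 1" "\<phi> 0 \<in> {0, 1}" "\<phi> 1 \<in> {0, 1}"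
  shows "(reparam n f \<phi>, reparam n f \<psi>) \<in> nloop_homotopy n X x"
proof -
  let ?I = "top_of_set {0..1::real}"
  let ?P = "prod_topology ?I (cube n)"
  define c where "c = (\<lambda>s u. (1 - s) * \<phi> u + s * \<psi> u)"
  have c01: "c s u \<in> {0..1}" if "s \<in> {0..1}" "u \<in> {0..1}" for s u
    using convexD_alt[OF convex_real_interval(5)[of 0 1], of "\<phi> u" "\<psi> u" s] \<phi>(2) \<psi>(2) that
    by (auto simp: c_def Pi_iff)
  have cont: "continuous_map ?P euclideanreal (\<lambda>p. \<theta> (snd p 0))" if "continuous_on {0..1} \<theta>" for \<theta> :: "real \<Rightarrow> real"
  proof -
    have "continuous_map ?I euclideanreal \<theta>" using that by simp
    from continuous_map_compose[OF continuous_map_cube_coord01[OF continuous_map_snd n] this]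
    show ?thesis by (simp add: o_def)
  qed
  have fst: "continuous_map ?P euclideanreal (\<lambda>p. fst p)"
    using continuous_map_fst[of ?I "cube n"] by (simp add: continuous_map_in_subtopology)
  have "continuous_map ?P euclideanreal (\<lambda>p. c (fst p) (snd p 0))"
    unfolding c_def
    by (intro continuous_map_add continuous_map_real_mult continuous_map_diff
        continuous_map_canonical_const fst cont \<phi>(1) \<psi>(1))
  moreover have u01: "t 0 \<in> {0..1}" if "t \<in> topspace (cube n)" for t
    using that n by (simp add: topspace_cube)
  ultimately have "continuous_map ?P ?I (\<lambda>p. c (fst p) (snd p 0))"
    using c01 by (auto simp: continuous_map_in_subtopology)
  from continuous_map_cube_upd[OF continuous_map_snd this n]
  have "continuous_map ?P (cube n) (\<lambda>p. (snd p)(0 := c (fst p) (snd p 0)))" .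
  moreover have "continuous_map (cube n) X f" using f by (simp add: nloops_def)
  ultimately have h: "continuous_map ?P X (\<lambda>p. f ((snd p)(0 := c (fst p) (snd p 0))))"
    using continuous_map_compose by (fastforce simp: o_def)
  show ?thesis
  proof (rule nloop_homotopyI[OF _ _ h])
    fix s t assume st: "s \<in> {0..1::real}" "t \<in> cube_boundary n"
    then have "t \<in> topspace (cube n)" using cube_boundary_subset by blast
    then have "c s (t 0) \<in> {0..1}" using c01 u01 st(1) by blast
    moreover have "c s u = 0 \<or> c s u = 1" if "u = 0 \<or> u = 1" for u
      using that ends by (auto simp: c_def algebra_simps)
    ultimately have "t(0 := c s (t 0)) \<in> cube_boundary n"
      using cube_upd_boundary_keep[OF st(2) _ n] by blast
    then show "f ((snd (s, t))(0 := c (fst (s, t)) (snd (s, t) 0))) = x"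
      using f by (simp add: nloops_def)
  qed (simp_all add: reparam_def c_def)
qed

section \<open>Concatenation and the group laws\<close>

lemma nloop_concat_homotopic:
  assumes n: "0 < n" and "(f, f') \<in> nloop_homotopy n X x" "(g, g') \<in> nloop_homotopy n X x"
  shows "(nloop_concat n f g, nloop_concat n f' g') \<in> nloop_homotopy n X x"
proof -
  let ?I = "top_of_set {0..1::real}"
  let ?P = "prod_topology ?I (cube n)"
  obtain F where F: "continuous_map ?P X F" "\<And>t. F (0, t) = f t" "\<And>t. F (1, t) = f' t"
    "\<And>s t. s \<in> {0..1} \<Longrightarrow> t \<in> cube_boundary n \<Longrightarrow> F (s, t) = x"
    using nloop_homotopyE[OF assms(2)] by blast
  obtain G where G: "continuous_map ?P X G" "\<And>t. G (0, t) = g t" "\<And>t. G (1, t) = g' t"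
    "\<And>s t. s \<in> {0..1} \<Longrightarrow> t \<in> cube_boundary n \<Longrightarrow> G (s, t) = x"
    using nloop_homotopyE[OF assms(3)] by blast
  \<comment> \<open>Clamped versions of \<open>2 * u\<close> and \<open>2 * u - 1\<close>, so that
    both halves are defined on the whole cube. At \<open>u = 1/2\<close> they reach 1 and 0, where
    both homotopies have the value \<open>x\<close>.\<close>
  define l r where "l = (\<lambda>u::real. min 1 (2 * u))" and "r = (\<lambda>u::real. max 0 (2 * u - 1))"
  have lr: "l u \<in> {0..1}" "r u \<in> {0..1}" if "u \<in> {0..1}" for u
    using that by (auto simp: l_def r_def)
  have lr_eq: "u \<le> 1/2 \<Longrightarrow> l u = 2 * u" "\<not> u \<le> 1/2 \<Longrightarrow> r u = 2 * u - 1" for u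
    by (auto simp: l_def r_def)
  have u01: "t 0 \<in> {0..1}" if "t \<in> topspace (cube n)" for t
    using that n by (simp add: topspace_cube)
  have coord: "continuous_map ?P euclideanreal (\<lambda>p. snd p 0)"
    by (rule continuous_map_cube_coord[OF continuous_map_snd])
  have cont: "continuous_map ?P X (\<lambda>p. H (fst p, (snd p)(0 := c (snd p 0))))"
    if H: "continuous_map ?P X H" and c: "continuous_map ?P euclideanreal (\<lambda>p. c (snd p 0))"
      and c01: "\<And>u. u \<in> {0..1} \<Longrightarrow> c u \<in> {0..1}" for H and c :: "real \<Rightarrow> real"
  proof -
    have "continuous_map ?P ?I (\<lambda>p. c (snd p 0))"
      using c c01 u01 by (auto simp: continuous_map_in_subtopology)
    from continuous_map_compose[OF continuous_map_pairedI[OF continuous_map_fst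
          continuous_map_cube_upd[OF continuous_map_snd this n]] H]
    show ?thesis by (simp add: o_def)
  qed
  have cl: "continuous_map ?P euclideanreal (\<lambda>p. l (snd p 0))"
    unfolding l_def by (intro continuous_map_real_min continuous_map_real_mult continuous_map_canonical_const coord)
  have cr: "continuous_map ?P euclideanreal (\<lambda>p. r (snd p 0))"
    unfolding r_def by (intro continuous_map_real_max continuous_map_real_mult continuous_map_diff
        continuous_map_canonical_const coord)
  have h: "continuous_map ?P X (\<lambda>p. if snd p 0 \<le> 1/2 then F (fst p, (snd p)(0 := l (snd p 0)))
      else G (fst p, (snd p)(0 := r (snd p 0))))"
  proof (rule continuous_map_cases_le[OF coord _
        continuous_map_from_subtopology[OF cont[OF F(1) cl lr(1)]]
        continuous_map_from_subtopology[OF cont[OF G(1) cr lr(2)]]])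
    fix p assume p: "p \<in> topspace ?P" "snd p 0 = 1/2"
    then have "fst p \<in> {0..1}" "snd p \<in> topspace (cube n)" "l (snd p 0) = 1" "r (snd p 0) = 0"
      by (auto simp: l_def r_def)
    then show "F (fst p, (snd p)(0 := l (snd p 0))) = G (fst p, (snd p)(0 := r (snd p 0)))"
      using F(4) G(4) cube_upd_boundary[OF _ n] by metis
  qed simp_all
  show ?thesis
  proof (rule nloop_homotopyI[OF _ _ h])
    fix s t assume st: "s \<in> {0..1::real}" "t \<in> cube_boundary n"
    then have "t \<in> topspace (cube n)" using cube_boundary_subset by blast
    note t01 = u01[OF this]
    have "t(0 := l (t 0)) \<in> cube_boundary n" "t(0 := r (t 0)) \<in> cube_boundary n"
      using st(2) lr[OF t01] n by (auto intro!: cube_upd_boundary_keep simp: l_def r_def)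
    then show "(if snd (s, t) 0 \<le> 1/2 then F (fst (s, t), (snd (s, t))(0 := l (snd (s, t) 0)))
        else G (fst (s, t), (snd (s, t))(0 := r (snd (s, t) 0)))) = x"
      using F(4) G(4) st(1) by simp
  qed (simp_all add: nloop_concat_def F(2,3) G(2,3) lr_eq)
qed

lemma nloop_homotopy_refl: "f \<in> nloops n X x \<Longrightarrow> (f, f) \<in> nloop_homotopy n X x"
  by (simp add: nloop_homotopy_def nloops_def)

text \<open>Compatibility with homotopy, applied to two constant homotopies, already contains
  membership.\<close>

lemma nloop_concat_closed:
  assumes "0 < n" "f \<in> nloops n X x" "g \<in> nloops n X x"
  shows "nloop_concat n f g \<in> nloops n X x"
  using nloop_concat_homotopic[OF assms(1) nloop_homotopy_refl[OF assms(2)] nloop_homotopy_refl[OF assms(3)]]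
  by (simp add: nloop_homotopy_def)

lemma const_nloop: "x \<in> topspace X \<Longrightarrow> (\<lambda>t \<in> topspace (cube n). x) \<in> nloops n X x"
  using cube_boundary_subset[of n]
  by (auto simp: nloops_def intro!: continuous_map_eq[of "cube n" X "\<lambda>_. x"])

text \<open>The product is a union over representatives. By compatibility all its members are the
  same class, and the index sets are nonempty because homotopy is reflexive.\<close>

lemma homotopy_group_mult:
  assumes n: "0 < n" and f: "f \<in> nloops n X x" and g: "g \<in> nloops n X x"
  shows "nloop_class n X x f \<otimes>\<^bsub>homotopy_group n X x\<^esub> nloop_class n X x g =
    nloop_class n X x (nloop_concat n f g)"
proof -
  have "nloop_class n X x (nloop_concat n f' g') = nloop_class n X x (nloop_concat n f g)"
    if "f' \<in> nloop_class n X x f" "g' \<in> nloop_class n X x g" for f' g'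
  proof -
    have "(nloop_concat n f g, nloop_concat n f' g') \<in> nloop_homotopy n X x"
      using nloop_concat_homotopic[OF n] that by (simp add: nloop_class_def)
    then show ?thesis
      unfolding nloop_class_def by (rule equiv_class_eq[OF equiv_nloop_homotopy, symmetric])
  qed
  then have "(\<Union>f'\<in>nloop_class n X x f. \<Union>g'\<in>nloop_class n X x g. nloop_class n X x (nloop_concat n f' g')) =
      (\<Union>f'\<in>nloop_class n X x f. \<Union>g'\<in>nloop_class n X x g. nloop_class n X x (nloop_concat n f g))"
    by (intro SUP_cong refl)
  moreover have "nloop_class n X x f \<noteq> {}" "nloop_class n X x g \<noteq> {}"
    using nloop_homotopy_refl[OF f] nloop_homotopy_refl[OF g] by (auto simp: nloop_class_def)
  ultimately show ?thesis
    by (simp add: homotopy_group_def)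
qed

lemma nloop_concat_upd:
  assumes "t \<in> topspace (cube n)" "0 < n" "s \<in> {0..1}"
  shows "nloop_concat n f g (t(0 := s)) = (if s \<le> 1/2 then f (t(0 := 2 * s)) else g (t(0 := 2 * s - 1)))"
  using cube_upd[OF assms] by (simp add: nloop_concat_def)

lemma reparam_id: "f \<in> nloops n X x \<Longrightarrow> reparam n f (\<lambda>u. u) = f"
  by (auto simp: reparam_def nloops_def extensional_def)

lemma nloop_concat_assoc:
  assumes n: "0 < n" and f: "f \<in> nloops n X x" "g \<in> nloops n X x" "h \<in> nloops n X x"
  shows "(nloop_concat n (nloop_concat n f g) h, nloop_concat n f (nloop_concat n g h)) \<in> nloop_homotopy n X x"
proof -
  \<comment> \<open>Piecewise linear with slopes 1/2, 1 and 2, taking the breakpoints 1/2 and 3/4 of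
    the right bracketing to the breakpoints 1/4 and 1/2 of the left one. Being convex, it is the
    maximum of its pieces, which makes continuity immediate.\<close>
  define \<phi> where "\<phi> = (\<lambda>u::real. max (u / 2) (max (u - 1/4) (2 * u - 1)))"
  let ?L = "nloop_concat n (nloop_concat n f g) h"
  have L: "?L \<in> nloops n X x" using n f by (intro nloop_concat_closed)
  have "reparam n ?L \<phi> = nloop_concat n f (nloop_concat n g h)"
  proof
    fix t show "reparam n ?L \<phi> t = nloop_concat n f (nloop_concat n g h) t"
    proof (cases "t \<in> topspace (cube n)")
      case True
      have t0: "t 0 \<in> {0..1}" using True n by (simp add: topspace_cube)
      have "reparam n ?L \<phi> t = ?L (t(0 := \<phi> (t 0)))" using True by (simp add: reparam_def)
      also have "\<dots> = nloop_concat n f (nloop_concat n g h) (t(0 := t 0))"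
      proof -
        consider "t 0 \<le> 1/2" | "1/2 < t 0" "t 0 \<le> 3/4" | "3/4 < t 0" by linarith
        then show ?thesis
        proof cases
          case 1
          then have eq: "\<phi> (t 0) = t 0 / 2" by (auto simp: \<phi>_def)
          show ?thesis unfolding eq using 1 t0 by (simp add: nloop_concat_upd[OF True n] del: fun_upd_triv)
        next
          case 2
          then have eq: "\<phi> (t 0) = t 0 - 1/4" by (auto simp: \<phi>_def)
          show ?thesis unfolding eq using 2 t0
            by (simp add: nloop_concat_upd[OF True n] algebra_simps del: fun_upd_triv)
        next
          case 3
          then have eq: "\<phi> (t 0) = 2 * t 0 - 1" by (auto simp: \<phi>_def)
          show ?thesis unfolding eq using 3 t0
            by (simp add: nloop_concat_upd[OF True n] algebra_simps del: fun_upd_triv)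
        qed
      qed
      finally show ?thesis by simp
    qed (simp add: reparam_def nloop_concat_def)
  qed
  moreover have "(reparam n ?L (\<lambda>u. u), reparam n ?L \<phi>) \<in> nloop_homotopy n X x"
  proof (rule reparam_homotopic[OF L n])
    show "continuous_on {0..1} \<phi>" unfolding \<phi>_def by (intro continuous_intros) auto
  qed (auto simp: \<phi>_def max_def)
  ultimately show ?thesis by (simp add: reparam_id[OF L])
qed

lemma nloop_concat_const_left:
  assumes n: "0 < n" and f: "f \<in> nloops n X x"
  shows "(nloop_concat n (\<lambda>t \<in> topspace (cube n). x) f, f) \<in> nloop_homotopy n X x"
proof -
  \<comment> \<open>Waits at 0 during the first half, where \<open>f\<close> has the value
    \<open>x\<close>, and then runs through \<open>f\<close> at double speed.\<close>
  define \<phi> where "\<phi> = (\<lambda>u::real. max 0 (2 * u - 1))"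
  have \<phi>: "\<phi> u = (if u \<le> 1/2 then 0 else 2 * u - 1)" for u by (simp add: \<phi>_def)
  have "reparam n f \<phi> = nloop_concat n (\<lambda>t \<in> topspace (cube n). x) f"
  proof
    fix t show "reparam n f \<phi> t = nloop_concat n (\<lambda>t \<in> topspace (cube n). x) f t"
    proof (cases "t \<in> topspace (cube n)")
      case True
      have t0: "t 0 \<in> {0..1}" using True n by (simp add: topspace_cube)
      have "f (t(0 := 0)) = x"
        using f cube_upd_boundary[OF True n] by (simp add: nloops_def)
      then show ?thesis
        using True t0 cube_upd[OF True n, of "2 * t 0"] by (simp add: reparam_def nloop_concat_def \<phi>)
    qed (simp add: reparam_def nloop_concat_def)
  qed
  moreover have "(reparam n f \<phi>, reparam n f (\<lambda>u. u)) \<in> nloop_homotopy n X x"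
  proof (rule reparam_homotopic[OF f n])
    show "continuous_on {0..1} \<phi>" unfolding \<phi>_def by (intro continuous_intros)
  qed (auto simp: \<phi>_def)
  ultimately show ?thesis by (simp add: reparam_id[OF f])
qed

lemma nloop_reverse:
  assumes n: "0 < n" and f: "f \<in> nloops n X x"
  shows "reparam n f (\<lambda>u. 1 - u) \<in> nloops n X x"
proof -
  have "(reparam n f (\<lambda>u. 1 - u), reparam n f (\<lambda>u. 1 - u)) \<in> nloop_homotopy n X x"
    by (rule reparam_homotopic[OF f n]) (auto intro!: continuous_intros)
  then show ?thesis by (simp add: nloop_homotopy_def)
qed

lemma nloop_concat_reverse_left:
  assumes n: "0 < n" and f: "f \<in> nloops n X x"
  shows "(nloop_concat n (reparam n f (\<lambda>u. 1 - u)) f, \<lambda>t \<in> topspace (cube n). x) \<in> nloop_homotopy n X x"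
proof -
  \<comment> \<open>The reverse of \<open>f\<close> followed by \<open>f\<close> traces
    \<open>f\<close> from 1 down to 0 and back to 1. Both ends are 1, so this is comparable with the
    constant 1, along which \<open>f\<close> has the value \<open>x\<close>.\<close>
  define \<phi> where "\<phi> = (\<lambda>u::real. \<bar>1 - 2 * u\<bar>)"
  have \<phi>: "\<phi> u = (if u \<le> 1/2 then 1 - 2 * u else 2 * u - 1)" for u by (simp add: \<phi>_def)
  have "reparam n f \<phi> = nloop_concat n (reparam n f (\<lambda>u. 1 - u)) f"
  proof
    fix t show "reparam n f \<phi> t = nloop_concat n (reparam n f (\<lambda>u. 1 - u)) f t"
    proof (cases "t \<in> topspace (cube n)")
      case True
      have t0: "t 0 \<in> {0..1}" using True n by (simp add: topspace_cube)
      show ?thesis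
        using True t0 cube_upd[OF True n, of "2 * t 0"] by (simp add: reparam_def nloop_concat_def \<phi>)
    qed (simp add: reparam_def nloop_concat_def)
  qed
  moreover have "reparam n f (\<lambda>_. 1) = (\<lambda>t \<in> topspace (cube n). x)"
    using f cube_upd_boundary[OF _ n, of _ 1] by (auto simp: reparam_def nloops_def)
  moreover have "(reparam n f \<phi>, reparam n f (\<lambda>_. 1)) \<in> nloop_homotopy n X x"
  proof (rule reparam_homotopic[OF f n])
    show "continuous_on {0..1} \<phi>" unfolding \<phi>_def by (intro continuous_intros)
  qed (auto simp: \<phi>_def)
  ultimately show ?thesis by simp
qed

lemma homotopy_groupE:
  assumes "A \<in> carrier (homotopy_group n X x)"
  obtains f where "f \<in> nloops n X x" "A = nloop_class n X x f"
  using assms by (auto simp: homotopy_group_def quotient_def nloop_class_def)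

lemma group_homotopy_group:
  assumes n: "0 < n" and x: "x \<in> topspace X"
  shows "group (homotopy_group n X x)"
proof -
  let ?G = "homotopy_group n X x" and ?q = "nloop_class n X x"
  have car: "?q f \<in> carrier ?G" if "f \<in> nloops n X x" for f
    using that by (auto simp: homotopy_group_def quotient_def nloop_class_def)
  have one: "\<one>\<^bsub>?G\<^esub> = ?q (\<lambda>t \<in> topspace (cube n). x)" by (simp add: homotopy_group_def)
  note mult = homotopy_group_mult[OF n] and closed = nloop_concat_closed[OF n]
  have qI: "?q f = ?q g" if "(f, g) \<in> nloop_homotopy n X x" for f g
    unfolding nloop_class_def by (rule equiv_class_eq[OF equiv_nloop_homotopy that])
  show ?thesis
  \<comment> \<open>\<open>groupI\<close> asks for a left unit and left inverses, which is why the
    preceding laws come in their left versions.\<close>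
  proof (rule groupI)
    fix A B assume "A \<in> carrier ?G" "B \<in> carrier ?G"
    then show "A \<otimes>\<^bsub>?G\<^esub> B \<in> carrier ?G"
      by (elim homotopy_groupE) (simp add: mult car closed)
  next
    show "\<one>\<^bsub>?G\<^esub> \<in> carrier ?G" unfolding one by (rule car[OF const_nloop[OF x]])
  next
    fix A B C assume "A \<in> carrier ?G" "B \<in> carrier ?G" "C \<in> carrier ?G"
    then show "A \<otimes>\<^bsub>?G\<^esub> B \<otimes>\<^bsub>?G\<^esub> C = A \<otimes>\<^bsub>?G\<^esub> (B \<otimes>\<^bsub>?G\<^esub> C)"
      by (elim homotopy_groupE) (simp add: mult closed qI[OF nloop_concat_assoc[OF n]])
  next
    fix A assume "A \<in> carrier ?G"
    then obtain f where f: "f \<in> nloops n X x" "A = ?q f" by (rule homotopy_groupE)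
    show "\<one>\<^bsub>?G\<^esub> \<otimes>\<^bsub>?G\<^esub> A = A"
      unfolding one f(2) mult[OF const_nloop[OF x] f(1)] by (rule qI[OF nloop_concat_const_left[OF n f(1)]])
    show "\<exists>B \<in> carrier ?G. B \<otimes>\<^bsub>?G\<^esub> A = \<one>\<^bsub>?G\<^esub>"
    proof (rule bexI)
      show "?q (reparam n f (\<lambda>u. 1 - u)) \<otimes>\<^bsub>?G\<^esub> A = \<one>\<^bsub>?G\<^esub>"
        unfolding one f(2) mult[OF nloop_reverse[OF n f(1)] f(1)]
        by (rule qI[OF nloop_concat_reverse_left[OF n f(1)]])
    qed (rule car[OF nloop_reverse[OF n f(1)]])
  qed
qed

text \<open>The product of two discrete topologies is discrete, so continuity of the operations
  reduces to closure of the carrier under them.\<close>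

lemma (in group) topological_group_discrete:
  "topological_group G (discrete_topology (carrier G))"
  by unfold_locales (auto simp flip: prod_topology_discrete_topology)

theorem theorem6p6:
  fixes n :: nat and X :: "'a topology" and x :: 'a
  assumes "n \<ge> 1"
    and "locally_n_connected n X"
    and "x \<in> topspace X"
  shows "topological_group (homotopy_group n X x) (homotopy_group_topology n X x) \<and>
    homotopy_group_topology n X x = discrete_topology (carrier (homotopy_group n X x))"
proof -
  have "homotopy_group_topology n X x = discrete_topology (carrier (homotopy_group n X x))"
    by (rule homotopy_group_topology_discrete[OF fillable_nloop_space[OF assms(2)]]) simp
  moreover have "group (homotopy_group n X x)"
    using assms(1,3) by (intro group_homotopy_group) simp
  ultimately show ?thesis
    using group.topological_group_discrete by metis
qed

end
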